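(* Let $g$ be the Kerr-(anti-)de Sitter metric with real parameters $a,m,\Lambda$ (see context). In the equatorial plane $\theta=\pi/2$ the invariant $I_5=k_\mu k^\mu$, $k_\mu=-\nabla_\mu(C_{\alpha\beta\gamma\delta}C^{\alpha\beta\gamma\delta})$, equals $$I_5=-\frac{27648\,\big((\Lambda r^2-3)a^2+\Lambda r^4+6mr-3r^2\big)m^4}{r^{16}}.$$ Thus in this case $I_5$ vanishes at the stationary horizons (the real nonzero roots $r$ of $\Delta_r$) of the Kerr black hole with cosmological constant.
   Context: Kerr-(anti-)de Sitter metric: in coordinates $(t,r,\theta,\phi)$, signature $(-,+,+,+)$, $$ds^2=-\frac{\Delta_r}{\Xi^2\rho^2}(dt-a\sin^2\theta\,d\phi)^2+\frac{\rho^2}{\Delta_r}dr^2+\frac{\rho^2}{\Delta_\theta}d\theta^2+\frac{\Delta_\theta\sin^2\theta}{\Xi^2\rho^2}\big(a\,dt-(r^2+a^2)d\phi\big)^2,$$ $\Delta_\theta=1+\frac{a^2\Lambda}{3}\cos^2\theta$, $\Xi=1+\frac{a^2\Lambda}{3}\neq0$, $\Delta_r=(1-\frac{\Lambda}{3}r^2)(r^2+a^2)-2mr$, $\rho^2=r^2+a^2\cos^2\theta$. $C_{\alpha\beta\gamma\delta}$ is the Weyl tensor of $g$. $I_5$ is a rational function of $(r,\cos\theta)$ with denominator a power of $\rho^2$, so it extends by continuity from the regular domain of the metric to points with $\Delta_r=0$, $\rho^2\ne0$. *)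

theory Defs
  imports "HOL-Analysis.Analysis"
begin

text \<open>A metric is given by its component matrix as a function of the coordinates.  All tensors are
  given by their components in the coordinate basis; the name of a tensor is followed by its
  arguments in the order point, indices from left to right.\<close>

type_synonym 'n metric = "real ^ 'n \<Rightarrow> real ^ 'n ^ 'n"

definition partial_deriv :: "'n::finite \<Rightarrow> (real ^ 'n \<Rightarrow> real) \<Rightarrow> real ^ 'n \<Rightarrow> real" where
  "partial_deriv i f x = deriv (\<lambda>s. f (x + s *\<^sub>R axis i 1)) 0"

definition inv_metric :: "'n::finite metric \<Rightarrow> 'n metric" where
  "inv_metric g x = matrix_inv (g x)"

text \<open>Levi-Civita connection, first index up: \<open>\<Gamma>\<^sup>i\<^sub>j\<^sub>k\<close>.\<close>

definition christoffel :: "'n::finite metric \<Rightarrow> real ^ 'n \<Rightarrow> 'n \<Rightarrow> 'n \<Rightarrow> 'n \<Rightarrow> real" where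
  "christoffel g x i j k =
     (1/2) * (\<Sum>l\<in>UNIV. inv_metric g x $ i $ l *
        (partial_deriv j (\<lambda>y. g y $ l $ k) x + partial_deriv k (\<lambda>y. g y $ j $ l) x
         - partial_deriv l (\<lambda>y. g y $ j $ k) x))"

text \<open>Curvature tensor \<open>R\<^sup>i\<^sub>j\<^sub>k\<^sub>l\<close>, first index up, with the sign convention
  \<open>R(\<partial>\<^sub>k, \<partial>\<^sub>l) \<partial>\<^sub>j = R\<^sup>i\<^sub>j\<^sub>k\<^sub>l \<partial>\<^sub>i\<close> where
  \<open>R(X, Y) = [\<nabla>\<^sub>X, \<nabla>\<^sub>Y] - \<nabla>\<^bsub>[X, Y]\<^esub>\<close>.\<close>

definition riemann_up :: "'n::finite metric \<Rightarrow> real ^ 'n \<Rightarrow> 'n \<Rightarrow> 'n \<Rightarrow> 'n \<Rightarrow> 'n \<Rightarrow> real" where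
  "riemann_up g x i j k l =
     partial_deriv k (\<lambda>y. christoffel g y i l j) x - partial_deriv l (\<lambda>y. christoffel g y i k j) x
     + (\<Sum>e\<in>UNIV. christoffel g x i k e * christoffel g x e l j
                 - christoffel g x i l e * christoffel g x e k j)"

definition riemann :: "'n::finite metric \<Rightarrow> real ^ 'n \<Rightarrow> 'n \<Rightarrow> 'n \<Rightarrow> 'n \<Rightarrow> 'n \<Rightarrow> real" where
  "riemann g x i j k l = (\<Sum>e\<in>UNIV. g x $ i $ e * riemann_up g x e j k l)"

definition ricci :: "'n::finite metric \<Rightarrow> real ^ 'n \<Rightarrow> 'n \<Rightarrow> 'n \<Rightarrow> real" where
  "ricci g x j l = (\<Sum>i\<in>UNIV. riemann_up g x i j i l)"

definition scalar_curv :: "'n::finite metric \<Rightarrow> real ^ 'n \<Rightarrow> real" where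
  "scalar_curv g x = (\<Sum>i\<in>UNIV. \<Sum>j\<in>UNIV. inv_metric g x $ i $ j * ricci g x i j)"

text \<open>All indices down; meaningful in dimension \<open>CARD('n) \<ge> 3\<close>.\<close>

definition weyl :: "'n::finite metric \<Rightarrow> real ^ 'n \<Rightarrow> 'n \<Rightarrow> 'n \<Rightarrow> 'n \<Rightarrow> 'n \<Rightarrow> real" where
  "weyl g x i j k l = riemann g x i j k l
     - 1 / (real CARD('n) - 2) *
       (g x $ i $ k * ricci g x j l - g x $ i $ l * ricci g x j k
        + g x $ j $ l * ricci g x i k - g x $ j $ k * ricci g x i l)
     + scalar_curv g x / ((real CARD('n) - 1) * (real CARD('n) - 2)) *
       (g x $ i $ k * g x $ j $ l - g x $ i $ l * g x $ j $ k)"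

definition weyl_upper :: "'n::finite metric \<Rightarrow> real ^ 'n \<Rightarrow> 'n \<Rightarrow> 'n \<Rightarrow> 'n \<Rightarrow> 'n \<Rightarrow> real" where
  "weyl_upper g x i j k l =
     (\<Sum>p\<in>UNIV. \<Sum>q\<in>UNIV. \<Sum>r\<in>UNIV. \<Sum>s\<in>UNIV.
        inv_metric g x $ i $ p * inv_metric g x $ j $ q *
        inv_metric g x $ k $ r * inv_metric g x $ l $ s * weyl g x p q r s)"

definition weyl_square :: "'n::finite metric \<Rightarrow> real ^ 'n \<Rightarrow> real" where
  "weyl_square g x =
     (\<Sum>i\<in>UNIV. \<Sum>j\<in>UNIV. \<Sum>k\<in>UNIV. \<Sum>l\<in>UNIV. weyl g x i j k l * weyl_upper g x i j k l)"

text \<open>On a scalar the covariant derivative is the partial derivative.\<close>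

definition k_covector :: "'n::finite metric \<Rightarrow> real ^ 'n \<Rightarrow> 'n \<Rightarrow> real" where
  "k_covector g x \<mu> = - partial_deriv \<mu> (weyl_square g) x"

definition I5 :: "'n::finite metric \<Rightarrow> real ^ 'n \<Rightarrow> real" where
  "I5 g x = (\<Sum>\<mu>\<in>UNIV. \<Sum>\<nu>\<in>UNIV. inv_metric g x $ \<mu> $ \<nu> * k_covector g x \<mu> * k_covector g x \<nu>)"

text \<open>Coordinates 1, 2, 3, 4 are \<open>t\<close>, \<open>r\<close>, \<open>\<theta>\<close>, \<open>\<phi>\<close>.\<close>

definition coords :: "real \<Rightarrow> real \<Rightarrow> real \<Rightarrow> real \<Rightarrow> real ^ 4" where
  "coords t r \<theta> \<phi> = vector [t, r, \<theta>, \<phi>]"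

definition Xi :: "real \<Rightarrow> real \<Rightarrow> real" where
  "Xi a \<Lambda> = 1 + a\<^sup>2 * \<Lambda> / 3"

definition Delta_theta :: "real \<Rightarrow> real \<Rightarrow> real \<Rightarrow> real" where
  "Delta_theta a \<Lambda> \<theta> = 1 + a\<^sup>2 * \<Lambda> / 3 * (cos \<theta>)\<^sup>2"

definition Delta_r :: "real \<Rightarrow> real \<Rightarrow> real \<Rightarrow> real \<Rightarrow> real" where
  "Delta_r a m \<Lambda> r = (1 - \<Lambda> / 3 * r\<^sup>2) * (r\<^sup>2 + a\<^sup>2) - 2 * m * r"

text \<open>This is \<open>\<rho>\<^sup>2\<close>, not \<open>\<rho>\<close>.\<close>

definition rho2 :: "real \<Rightarrow> real \<Rightarrow> real \<Rightarrow> real" where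
  "rho2 a r \<theta> = r\<^sup>2 + a\<^sup>2 * (cos \<theta>)\<^sup>2"

text \<open>The line element is a combination of squares of the one-forms \<open>dt - a sin\<^sup>2\<theta> d\<phi>\<close>,
  \<open>dr\<close>, \<open>d\<theta>\<close> and \<open>a dt - (r\<^sup>2 + a\<^sup>2) d\<phi>\<close>; a one-form is given by its vector of
  components, so \<open>d\<close> of the \<open>i\<close>-th coordinate is \<open>axis i 1\<close>.\<close>

definition kerr_ds_metric :: "real \<Rightarrow> real \<Rightarrow> real \<Rightarrow> 4 metric" where
  "kerr_ds_metric a m \<Lambda> x =
     (let r = x $ 2; \<theta> = x $ 3;
          dt = axis 1 1; dr = axis 2 1; d\<theta> = axis 3 1; d\<phi> = axis 4 1;
          \<alpha> = dt - (a * (sin \<theta>)\<^sup>2) *\<^sub>R d\<phi>;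
          \<beta> = a *\<^sub>R dt - (r\<^sup>2 + a\<^sup>2) *\<^sub>R d\<phi>
      in \<chi> i j.
          - Delta_r a m \<Lambda> r / ((Xi a \<Lambda>)\<^sup>2 * rho2 a r \<theta>) * (\<alpha> $ i * \<alpha> $ j)
          + rho2 a r \<theta> / Delta_r a m \<Lambda> r * (dr $ i * dr $ j)
          + rho2 a r \<theta> / Delta_theta a \<Lambda> \<theta> * (d\<theta> $ i * d\<theta> $ j)
          + Delta_theta a \<Lambda> \<theta> * (sin \<theta>)\<^sup>2 / ((Xi a \<Lambda>)\<^sup>2 * rho2 a r \<theta>) * (\<beta> $ i * \<beta> $ j))"

text \<open>The points at which (for \<open>Xi a \<Lambda> \<noteq> 0\<close>) the components are smooth and the metric is
  nondegenerate with one negative direction.  Positivity of \<open>Delta_theta\<close> is needed for the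
  signature, and \<open>Delta_r\<close> may have either sign.\<close>

definition kerr_ds_domain :: "real \<Rightarrow> real \<Rightarrow> real \<Rightarrow> (real ^ 4) set" where
  "kerr_ds_domain a m \<Lambda> =
     {x. 0 < x $ 3 \<and> x $ 3 < pi \<and> rho2 a (x $ 2) (x $ 3) \<noteq> 0 \<and>
         Delta_r a m \<Lambda> (x $ 2) \<noteq> 0 \<and> Delta_theta a \<Lambda> (x $ 3) > 0}"

text \<open>At points with \<open>Delta_r = 0\<close> the metric components are singular and
  \<open>I5 (kerr_ds_metric a m \<Lambda>)\<close> is meaningless there, so its value is taken by continuity from
  \<open>kerr_ds_domain\<close>.  This is significant only where the limit exists and is unique.\<close>

definition kerr_ds_I5 :: "real \<Rightarrow> real \<Rightarrow> real \<Rightarrow> real ^ 4 \<Rightarrow> real" where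
  "kerr_ds_I5 a m \<Lambda> x =
     (if x \<in> kerr_ds_domain a m \<Lambda> then I5 (kerr_ds_metric a m \<Lambda>) x
      else Lim (at x within kerr_ds_domain a m \<Lambda>) (I5 (kerr_ds_metric a m \<Lambda>)))"

end

theory Submission
  imports Defs
begin

text \<open>The unnormalised Carter frame diagonalises the metric.  In it the connection is rational in
  \<open>r\<close> and \<open>u = cos \<theta>\<close>, and Cartan's structure equations give a Riemann tensor that is
  \<open>\<Lambda>/3 (g\<^sub>i\<^sub>k g\<^sub>j\<^sub>l - g\<^sub>i\<^sub>l g\<^sub>j\<^sub>k)\<close> plus a trace-free part of type D governed by the single complex number
  \<open>\<Psi> = m / (r - \<i> a u)\<^sup>3\<close>.  Hence the metric is Einstein, the trace-free part is the Weyl tensor, and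
  its square is \<open>48 Re \<Psi>\<^sup>2\<close>.  In \<open>I\<^sub>5 = \<rho>\<^sup>-\<^sup>2 (\<Delta>\<^sub>r (\<partial>\<^sub>r K)\<^sup>2 + \<Delta>\<^sub>\<theta> (\<partial>\<^sub>\<theta> K)\<^sup>2)\<close> the second term vanishes on the
  equator, because \<open>K\<close> is even in \<open>u\<close>, and the first carries the factor \<open>\<Delta>\<^sub>r\<close>.  The right-hand side is
  continuous wherever \<open>\<rho>\<^sup>2 \<noteq> 0\<close>, which settles the horizons.\<close>

section \<open>Partial derivatives and Einstein metrics\<close>

text \<open>The obstacle is size: expanding the Weyl tensor from coordinate Christoffel symbols
  yields unmanageable expressions. All index manipulation is therefore done once, for an arbitrary
  metric that is diagonal in a frame, and the concrete metric enters only through tables of rational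
  functions. For these, only entrywise derivatives and polynomial identities remain to be checked.
  The price of a rational frame is that its norms \<open>N\<close> are not constant, so their
  derivatives appear in the structure equations. The operator \<open>deriv\<close> is total and
  obeys the usual rules only for differentiable functions; hence the relation
  \<open>has_partial_deriv\<close>, which carries existence together with the value. The formulas
  hold only on the domain, and they may be differentiated because the domain is open.\<close>

definition has_partial_deriv :: "(real ^ 'n::finite \<Rightarrow> real) \<Rightarrow> 'n \<Rightarrow> real \<Rightarrow> real ^ 'n \<Rightarrow> bool" where
  "has_partial_deriv f i d x \<longleftrightarrow> ((\<lambda>s. f (x + s *\<^sub>R axis i 1)) has_real_derivative d) (at 0)"

lemma has_partial_deriv_imp: "has_partial_deriv f i d x \<Longrightarrow> partial_deriv i f x = d"
  by (simp add: has_partial_deriv_def partial_deriv_def DERIV_imp_deriv)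

lemma has_partial_deriv_unique:
  "has_partial_deriv f i d x \<Longrightarrow> has_partial_deriv f i e x \<Longrightarrow> d = e"
  unfolding has_partial_deriv_def by (rule DERIV_unique)

lemma has_partial_deriv_add:
  "has_partial_deriv f i d x \<Longrightarrow> has_partial_deriv h i e x \<Longrightarrow> has_partial_deriv (\<lambda>y. f y + h y) i (d + e) x"
  unfolding has_partial_deriv_def by (rule DERIV_add)

lemma has_partial_deriv_mult:
  assumes "has_partial_deriv f i d x" "has_partial_deriv h i e x"
  shows "has_partial_deriv (\<lambda>y. f y * h y) i (d * h x + f x * e) x"
  using DERIV_mult[OF assms[unfolded has_partial_deriv_def]]
  by (simp add: has_partial_deriv_def algebra_simps)

lemma has_partial_deriv_divide:
  assumes "has_partial_deriv f i d x" "has_partial_deriv h i e x" "h x \<noteq> 0"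
  shows "has_partial_deriv (\<lambda>y. f y / h y) i ((d * h x - f x * e) / (h x * h x)) x"
  using DERIV_divide[OF assms(1,2)[unfolded has_partial_deriv_def]] assms(3)
  by (simp add: has_partial_deriv_def)

lemma has_partial_deriv_sum:
  assumes "\<And>a. a \<in> A \<Longrightarrow> has_partial_deriv (f a) i (d a) x"
  shows "has_partial_deriv (\<lambda>y. \<Sum>a\<in>A. f a y) i (\<Sum>a\<in>A. d a) x"
  using assms unfolding has_partial_deriv_def by (intro DERIV_sum) auto

lemmas has_partial_deriv_intros =
  has_partial_deriv_add has_partial_deriv_mult has_partial_deriv_divide has_partial_deriv_sum

lemma eventually_along_axis:
  fixes x :: "real ^ 'n::finite"
  assumes "open U" "x \<in> U"
  shows "\<forall>\<^sub>F s in nhds 0. x + s *\<^sub>R axis i 1 \<in> U"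
proof -
  have "((\<lambda>s. x + s *\<^sub>R axis i 1) \<longlongrightarrow> x + 0 *\<^sub>R axis i 1) (nhds 0)"
    by (intro tendsto_intros filterlim_ident)
  then show ?thesis
    using assms by (auto intro: topological_tendstoD)
qed

lemma has_partial_deriv_cong:
  assumes "open U" "x \<in> U" "\<And>y. y \<in> U \<Longrightarrow> f y = h y" "has_partial_deriv f i d x"
  shows "has_partial_deriv h i d x"
proof -
  have "\<forall>\<^sub>F s in nhds 0. f (x + s *\<^sub>R axis i 1) = h (x + s *\<^sub>R axis i 1)"
    using eventually_along_axis[OF assms(1,2)] by (rule eventually_mono) (rule assms(3))
  then show ?thesis
    using assms(4) unfolding has_partial_deriv_def by (simp add: DERIV_cong_ev[OF refl _ refl])
qed

lemma partial_deriv_cong: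
  assumes "open U" "x \<in> U" "\<And>y. y \<in> U \<Longrightarrow> f y = h y"
  shows "partial_deriv i f x = partial_deriv i h x"
proof -
  have "\<forall>\<^sub>F s in nhds 0. f (x + s *\<^sub>R axis i 1) = h (x + s *\<^sub>R axis i 1)"
    using eventually_along_axis[OF assms(1,2)] by (rule eventually_mono) (rule assms(3))
  then show ?thesis
    unfolding partial_deriv_def by (rule deriv_cong_ev) simp
qed

lemma sum_delta_mult:
  fixes f :: "'n::finite \<Rightarrow> real"
  shows "(\<Sum>b\<in>UNIV. (if a = b then 1 else 0) * f b) = f a" "(\<Sum>b\<in>UNIV. (if b = a then 1 else 0) * f b) = f a"
    "(\<Sum>b\<in>UNIV. f b * (if a = b then 1 else 0)) = f a" "(\<Sum>b\<in>UNIV. f b * (if b = a then 1 else 0)) = f a"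
  by (simp_all add: if_distrib[of "\<lambda>z. z * _"] if_distrib[of "\<lambda>z. _ * z"] cong: if_cong)

text \<open>Koszul's argument: inserting \<open>compat\<close> into the combination of metric
  derivatives gives six terms; by \<open>tors\<close> and \<open>sym\<close> four of them cancel and
  the other two coincide. This lets a connection be built from the frame and then recognised as
  Levi-Civita.\<close>

lemma christoffel_unique:
  fixes g :: "'n::finite metric"
  assumes inv: "\<And>i k. (\<Sum>l\<in>UNIV. inv_metric g x $ i $ l * g x $ l $ k) = (if i = k then 1 else 0)"
    and sym: "\<And>i j. g x $ i $ j = g x $ j $ i"
    and tors: "\<And>i j k. G i j k = G i k j"
    and compat: "\<And>i j l. partial_deriv l (\<lambda>y. g y $ i $ j) x =
      (\<Sum>e\<in>UNIV. g x $ e $ j * G e l i + g x $ i $ e * G e l j)"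
  shows "christoffel g x i j k = G i j k"
proof -
  have *: "partial_deriv j (\<lambda>y. g y $ l $ k) x + partial_deriv k (\<lambda>y. g y $ j $ l) x
         - partial_deriv l (\<lambda>y. g y $ j $ k) x = 2 * (\<Sum>e\<in>UNIV. g x $ l $ e * G e j k)" for l
    unfolding compat sum.distrib[symmetric] sum_subtractf[symmetric] sum_distrib_left
  proof (intro sum.cong refl)
    fix e
    show "g x $ e $ k * G e j l + g x $ l $ e * G e j k + (g x $ e $ l * G e k j + g x $ j $ e * G e k l)
        - (g x $ e $ k * G e l j + g x $ j $ e * G e l k) = 2 * (g x $ l $ e * G e j k)"
      using sym[of e l] tors[of e l j] tors[of e k j] tors[of e k l] by simp
  qed
  have "christoffel g x i j k = (\<Sum>l\<in>UNIV. \<Sum>e\<in>UNIV. inv_metric g x $ i $ l * g x $ l $ e * G e j k)"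
    unfolding christoffel_def * by (simp add: sum_distrib_left mult.assoc mult.left_commute)
  also have "\<dots> = (\<Sum>e\<in>UNIV. (\<Sum>l\<in>UNIV. inv_metric g x $ i $ l * g x $ l $ e) * G e j k)"
    by (subst sum.swap) (simp add: sum_distrib_right)
  also have "\<dots> = G i j k"
    unfolding inv by (rule sum_delta_mult)
  finally show ?thesis .
qed

text \<open>When Ricci is a multiple of the metric, both trace corrections in \<open>weyl\<close>
  are multiples of the constant-curvature tensor, and their coefficients 2c/(n-2) and
  cn/((n-1)(n-2)) differ by c/(n-1).\<close>

lemma weyl_einstein:
  fixes g :: "'n::finite metric"
  assumes inv: "\<And>i k. (\<Sum>l\<in>UNIV. inv_metric g x $ i $ l * g x $ l $ k) = (if i = k then 1 else 0)"
    and sym: "\<And>i j. g x $ i $ j = g x $ j $ i"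
    and ric: "\<And>i j. ricci g x i j = c * g x $ i $ j"
    and dim: "CARD('n) \<ge> 3"
  shows "weyl g x i j k l = riemann g x i j k l
     - c / (real CARD('n) - 1) * (g x $ i $ k * g x $ j $ l - g x $ i $ l * g x $ j $ k)"
proof -
  have "scalar_curv g x = c * (\<Sum>i\<in>UNIV. \<Sum>j\<in>UNIV. inv_metric g x $ i $ j * g x $ j $ i)"
    unfolding scalar_curv_def ric sum_distrib_left
    by (intro sum.cong refl) (metis sym mult.left_commute)
  also have "\<dots> = c * real CARD('n)"
    unfolding inv by simp
  finally have s: "scalar_curv g x = c * real CARD('n)" .
  define n where "n = real CARD('n)"
  have n: "n - 1 \<noteq> 0" "n - 2 \<noteq> 0" using dim unfolding n_def by auto
  have e: "1 / (n - 2) * (2 * c) - c * n / ((n - 1) * (n - 2)) = c / (n - 1)"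
    using n by (simp add: divide_simps) (simp add: algebra_simps)
  have "weyl g x i j k l = riemann g x i j k l - (1 / (n - 2) * (2 * c) - c * n / ((n - 1) * (n - 2)))
     * (g x $ i $ k * g x $ j $ l - g x $ i $ l * g x $ j $ k)"
    unfolding weyl_def s ric n_def[symmetric] by (simp add: algebra_simps)
  then show ?thesis unfolding e unfolding n_def .
qed

section \<open>Curvature in a moving frame\<close>

text \<open>Moves a frame sum out of a contraction over two coordinate indices, so that
  \<open>einstein_weyl_square\<close> can go on to the next index pair.\<close>

lemma sum_pair_swap:
  fixes h :: "'n::finite \<Rightarrow> 'n \<Rightarrow> real"
  shows "(\<Sum>i\<in>UNIV. \<Sum>p\<in>UNIV. h i p * (\<Sum>a\<in>UNIV. F a i p / n a)) = (\<Sum>a\<in>UNIV. (\<Sum>i\<in>UNIV. \<Sum>p\<in>UNIV. h i p * F a i p) / n a)"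
proof -
  have "(\<Sum>i\<in>UNIV. \<Sum>p\<in>UNIV. h i p * (\<Sum>a\<in>UNIV. F a i p / n a)) = (\<Sum>i\<in>UNIV. \<Sum>a\<in>UNIV. \<Sum>p\<in>UNIV. h i p * F a i p / n a)"
    unfolding sum_distrib_left times_divide_eq_right by (intro sum.cong refl sum.swap)
  also have "\<dots> = (\<Sum>a\<in>UNIV. \<Sum>i\<in>UNIV. \<Sum>p\<in>UNIV. h i p * F a i p / n a)"
    by (rule sum.swap)
  finally show ?thesis unfolding sum_divide_distrib .
qed

lemma matrix_diff_ldistrib: "(A :: real ^ 'n ^ 'm) ** (B - C) = A ** B - A ** C"
  by (simp add: matrix_matrix_mult_def vec_eq_iff sum_subtractf right_diff_distrib)

lemma matrix_diff_rdistrib: "((A :: real ^ 'n ^ 'm) - B) ** C = A ** C - B ** C"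
  by (simp add: matrix_matrix_mult_def vec_eq_iff sum_subtractf left_diff_distrib)

lemma matrix_add_rdistrib: "((A :: real ^ 'n ^ 'm) + B) ** C = A ** C + B ** C"
  by (simp add: matrix_matrix_mult_def vec_eq_iff sum.distrib distrib_right)

text \<open>Gauge covariance of curvature as bare matrix algebra. The hypotheses say that the
  coframe \<open>Q\<close> intertwines the Christoffel matrices with the connection forms, and give
  the derivatives of that relation. Both derivatives contain the same \<open>ddQ\<close>, since
  mixed second partials commute, and it cancels in the antisymmetrisation.\<close>

lemma cartan_structure_matrix:
  fixes Q :: "real ^ 'n::finite ^ 'n"
  assumes k: "Q ** Gk = dQk + wk ** Q" and l: "Q ** Gl = dQl + wl ** Q"
    and lk: "dQl ** Gk + Q ** dGlk = ddQ + (dwlk ** Q + wk ** dQl)"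
    and kl: "dQk ** Gl + Q ** dGkl = ddQ + (dwkl ** Q + wl ** dQk)"
  shows "Q ** (dGkl - dGlk + (Gk ** Gl - Gl ** Gk)) = (dwkl - dwlk + (wk ** wl - wl ** wk)) ** Q"
proof -
  have "Q ** (dGkl - dGlk + (Gk ** Gl - Gl ** Gk)) = Q ** dGkl - Q ** dGlk + ((Q ** Gk) ** Gl - (Q ** Gl) ** Gk)"
    by (simp add: matrix_add_ldistrib matrix_diff_ldistrib matrix_mul_assoc)
  also have "Q ** dGkl = ddQ + (dwkl ** Q + wl ** dQk) - dQk ** Gl" using kl by (simp add: algebra_simps)
  also have "Q ** dGlk = ddQ + (dwlk ** Q + wk ** dQl) - dQl ** Gk" using lk by (simp add: algebra_simps)
  also have "(Q ** Gk) ** Gl = dQk ** Gl + wk ** (dQl + wl ** Q)"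
    unfolding k l[symmetric] by (simp add: matrix_add_rdistrib matrix_mul_assoc)
  also have "(Q ** Gl) ** Gk = dQl ** Gk + wl ** (dQk + wk ** Q)"
    unfolding l k[symmetric] by (simp add: matrix_add_rdistrib matrix_mul_assoc)
  finally show ?thesis
    by (simp add: matrix_add_ldistrib matrix_add_rdistrib matrix_diff_rdistrib matrix_diff_ldistrib
        matrix_mul_assoc algebra_simps)
qed

text \<open>A metric that is diagonal in a moving frame, in the notation: coframe component \<open>Q a i\<close> of
  \<open>\<theta>\<^sup>a\<close> along the \<open>i\<close>-th coordinate, dual frame vectors \<open>e\<^sub>a\<close> with components \<open>P i a\<close>,
  \<open>N a = g(e\<^sub>a, e\<^sub>a)\<close>, which need not be constant, and \<open>W c a b = g(\<nabla>\<^bsub>e\<^sub>c\<^esub> e\<^sub>b, e\<^sub>a)\<close>.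
  A prefixed \<open>d\<close> is a coordinate derivative and a prefixed \<open>e\<close> a derivative along the frame,
  with the index of the differentiation first.\<close>

locale moving_frame =
  fixes g :: "'n::finite metric"
    and U :: "(real ^ 'n) set"
    and Q P :: "'n \<Rightarrow> 'n \<Rightarrow> real ^ 'n \<Rightarrow> real"
    and N :: "'n \<Rightarrow> real ^ 'n \<Rightarrow> real"
    and W :: "'n \<Rightarrow> 'n \<Rightarrow> 'n \<Rightarrow> real ^ 'n \<Rightarrow> real"
    and dQ :: "'n \<Rightarrow> 'n \<Rightarrow> 'n \<Rightarrow> real ^ 'n \<Rightarrow> real"
    and ddQ :: "'n \<Rightarrow> 'n \<Rightarrow> 'n \<Rightarrow> 'n \<Rightarrow> real ^ 'n \<Rightarrow> real"
    and eN :: "'n \<Rightarrow> 'n \<Rightarrow> real ^ 'n \<Rightarrow> real"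
    and eW :: "'n \<Rightarrow> 'n \<Rightarrow> 'n \<Rightarrow> 'n \<Rightarrow> real ^ 'n \<Rightarrow> real"
  assumes open_U: "open U"
    and g_eq: "y \<in> U \<Longrightarrow> g y $ i $ j = (\<Sum>a\<in>UNIV. N a y * Q a i y * Q a j y)"
    and QP: "y \<in> U \<Longrightarrow> (\<Sum>i\<in>UNIV. Q a i y * P i b y) = (if a = b then 1 else 0)"
    and PQ: "y \<in> U \<Longrightarrow> (\<Sum>a\<in>UNIV. P i a y * Q a j y) = (if i = j then 1 else 0)"
    and N_nz: "y \<in> U \<Longrightarrow> N a y \<noteq> 0"
    and Q_deriv: "y \<in> U \<Longrightarrow> has_partial_deriv (Q a i) k (dQ k a i y) y"
    and dQ_deriv: "y \<in> U \<Longrightarrow> has_partial_deriv (dQ k a i) l (ddQ l k a i y) y"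
    and ddQ_sym: "y \<in> U \<Longrightarrow> ddQ l k a i y = ddQ k l a i y"
    and P_deriv: "y \<in> U \<Longrightarrow> \<exists>d. has_partial_deriv (P i a) k d y"
    and N_deriv: "y \<in> U \<Longrightarrow> has_partial_deriv (N a) k (\<Sum>c\<in>UNIV. Q c k y * eN c a y) y"
    and W_deriv: "y \<in> U \<Longrightarrow> has_partial_deriv (W d a b) k (\<Sum>c\<in>UNIV. Q c k y * eW c d a b y) y"
    and torsion: "y \<in> U \<Longrightarrow> N a y * (dQ k a i y - dQ i a k y) =
       (\<Sum>c\<in>UNIV. \<Sum>d\<in>UNIV. (W d a c y - W c a d y) * Q c k y * Q d i y)"
    and compat: "y \<in> U \<Longrightarrow> W c a b y + W c b a y = (if a = b then eN c a y else 0)"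
begin

section \<open>The Levi-Civita connection in a moving frame\<close>

definition om :: "'n \<Rightarrow> 'n \<Rightarrow> 'n \<Rightarrow> real ^ 'n \<Rightarrow> real" where
  "om k a b y = (\<Sum>c\<in>UNIV. Q c k y * (W c a b y / N a y))"

text \<open>The coordinate connection for which the coframe is covariantly constant in both of its
  indices: \<open>dQ + om Q = Q conn\<close>, solved for \<open>conn\<close> with the dual frame
  \<open>P\<close>.\<close>

definition conn :: "'n \<Rightarrow> 'n \<Rightarrow> 'n \<Rightarrow> real ^ 'n \<Rightarrow> real" where
  "conn i k j y = (\<Sum>a\<in>UNIV. P i a y * (dQ k a j y + (\<Sum>b\<in>UNIV. om k a b y * Q b j y)))"

text \<open>The components \<open>R(e\<^sub>a, e\<^sub>b, e\<^sub>c, e\<^sub>d)\<close> by Cartan's second structure equation with all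
  indices lowered.  Lowering \<open>a\<close> differentiates \<open>N a\<close>, and metric compatibility turns this into the
  index order of the quadratic term; the last sum accounts for the commutator of \<open>e\<^sub>c\<close> and \<open>e\<^sub>d\<close>.\<close>

definition frame_riemann :: "'n \<Rightarrow> 'n \<Rightarrow> 'n \<Rightarrow> 'n \<Rightarrow> real ^ 'n \<Rightarrow> real" where
  "frame_riemann a b c d y = eW c d a b y - eW d c a b y
     - (\<Sum>e\<in>UNIV. (W c e a y * W d e b y - W d e a y * W c e b y) / N e y)
     + (\<Sum>f\<in>UNIV. (W d f c y - W c f d y) * W f a b y / N f y)"

lemma frame_contract: "y \<in> U \<Longrightarrow> (\<Sum>i\<in>UNIV. Q a i y * (\<Sum>b\<in>UNIV. P i b y * X b)) = X a"
proof -
  assume y: "y \<in> U"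
  have "(\<Sum>i\<in>UNIV. Q a i y * (\<Sum>b\<in>UNIV. P i b y * X b)) = (\<Sum>b\<in>UNIV. (\<Sum>i\<in>UNIV. Q a i y * P i b y) * X b)"
    unfolding sum_distrib_left sum_distrib_right by (subst sum.swap) (simp add: mult.assoc)
  then show ?thesis unfolding QP[OF y] sum_delta_mult .
qed

lemma coframe_contract: "y \<in> U \<Longrightarrow> (\<Sum>a\<in>UNIV. P i a y * (\<Sum>j\<in>UNIV. Q a j y * X j)) = X i"
proof -
  assume y: "y \<in> U"
  have "(\<Sum>a\<in>UNIV. P i a y * (\<Sum>j\<in>UNIV. Q a j y * X j)) = (\<Sum>j\<in>UNIV. (\<Sum>a\<in>UNIV. P i a y * Q a j y) * X j)"
    unfolding sum_distrib_left sum_distrib_right by (subst sum.swap) (simp add: mult.assoc)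
  then show ?thesis unfolding PQ[OF y] sum_delta_mult .
qed

lemma Q_inject:
  assumes y: "y \<in> U" and "\<And>a. (\<Sum>i\<in>UNIV. Q a i y * X i) = (\<Sum>i\<in>UNIV. Q a i y * Z i)"
  shows "X i = Z i"
  using coframe_contract[OF y, of i X] coframe_contract[OF y, of i Z] assms(2) by simp

lemma g_contract: "y \<in> U \<Longrightarrow> (\<Sum>e\<in>UNIV. g y $ i $ e * X e) = (\<Sum>a\<in>UNIV. N a y * Q a i y * (\<Sum>e\<in>UNIV. Q a e y * X e))"
  unfolding sum_distrib_left by (subst sum.swap) (simp add: g_eq sum_distrib_right mult.assoc)

lemma g_sym: "y \<in> U \<Longrightarrow> g y $ i $ j = g y $ j $ i"
  by (simp add: g_eq mult.commute mult.left_commute)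

text \<open>\<open>matrix_inv\<close> is a choice, so a two-sided inverse is exhibited and
  uniqueness identifies it; for square matrices one side yields the other.\<close>

lemma inv_metric_eq:
  assumes y: "y \<in> U"
  shows "inv_metric g y $ i $ j = (\<Sum>a\<in>UNIV. P i a y * P j a y / N a y)"
proof -
  define B :: "real ^ 'n ^ 'n" where "B = (\<chi> i j. \<Sum>a\<in>UNIV. P i a y * P j a y / N a y)"
  have "g y ** B = mat 1"
  proof -
    have "(\<Sum>e\<in>UNIV. g y $ i $ e * B $ e $ j) = (if i = j then 1 else 0)" for i j
    proof -
      have B: "B $ e $ j = (\<Sum>b\<in>UNIV. P e b y * (P j b y / N b y))" for e
        by (simp add: B_def)
      have "(\<Sum>e\<in>UNIV. g y $ i $ e * B $ e $ j) = (\<Sum>a\<in>UNIV. P j a y * Q a i y)"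
        unfolding g_contract[OF y] B frame_contract[OF y] using N_nz[OF y]
        by (simp add: mult.commute)
      then show ?thesis by (simp add: PQ[OF y])
    qed
    then show ?thesis by (simp add: matrix_matrix_mult_def mat_def vec_eq_iff)
  qed
  moreover from this have "B ** g y = mat 1" by (simp add: matrix_left_right_inverse)
  ultimately have "inv_metric g y = B"
    unfolding inv_metric_def matrix_inv_def
    by (metis (mono_tags, lifting) matrix_mul_assoc matrix_mul_lid matrix_mul_rid someI_ex)
  then show ?thesis by (simp add: B_def)
qed

lemma inv_metric_mult:
  assumes y: "y \<in> U"
  shows "(\<Sum>l\<in>UNIV. inv_metric g y $ i $ l * g y $ l $ k) = (if i = k then 1 else 0)"
proof -
  have B: "inv_metric g y $ i $ l = (\<Sum>b\<in>UNIV. P l b y * (P i b y / N b y))" for l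
    by (simp add: inv_metric_eq[OF y] mult.commute)
  have "(\<Sum>l\<in>UNIV. inv_metric g y $ i $ l * g y $ l $ k) = (\<Sum>l\<in>UNIV. g y $ k $ l * inv_metric g y $ i $ l)"
    by (intro sum.cong refl) (metis g_sym[OF y] mult.commute)
  also have "\<dots> = (\<Sum>a\<in>UNIV. P i a y * Q a k y)"
    unfolding g_contract[OF y] B frame_contract[OF y] using N_nz[OF y] by (simp add: mult.commute)
  finally show ?thesis by (simp add: PQ[OF y])
qed

lemma Q_conn:
  assumes "y \<in> U"
  shows "(\<Sum>i\<in>UNIV. Q a i y * conn i k j y) = dQ k a j y + (\<Sum>b\<in>UNIV. om k a b y * Q b j y)"
  unfolding conn_def by (rule frame_contract[OF assms])

lemma om_Q: "(\<Sum>b\<in>UNIV. om k a b y * Q b j y) = (\<Sum>c\<in>UNIV. \<Sum>b\<in>UNIV. W c a b y * Q c k y * Q b j y) / N a y"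
  unfolding om_def sum_distrib_right sum_divide_distrib
  by (subst sum.swap) (simp add: mult.commute mult.left_commute)

text \<open>\<open>torsion\<close> is Cartan's first structure equation in lowered form: the
  antisymmetric part of \<open>dQ\<close> is opposite to that of the term with \<open>om\<close>.
  Contracting with the invertible coframe loses nothing.\<close>

lemma conn_sym:
  assumes y: "y \<in> U"
  shows "conn i k j y = conn i j k y"
proof (rule Q_inject[OF y, where X = "\<lambda>i. conn i k j y" and Z = "\<lambda>i. conn i j k y"])
  fix a
  have "N a y * (dQ k a j y - dQ j a k y) + N a y * ((\<Sum>b\<in>UNIV. om k a b y * Q b j y) - (\<Sum>b\<in>UNIV. om j a b y * Q b k y)) = 0"
  proof -
    have s: "(\<Sum>c\<in>UNIV. \<Sum>b\<in>UNIV. W c a b y * Q c j y * Q b k y) = (\<Sum>c\<in>UNIV. \<Sum>b\<in>UNIV. W b a c y * Q c k y * Q b j y)"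
      by (subst sum.swap) (simp add: mult.commute mult.left_commute)
    have "N a y * (dQ k a j y - dQ j a k y) = (\<Sum>c\<in>UNIV. \<Sum>b\<in>UNIV. W b a c y * Q c k y * Q b j y)
        - (\<Sum>c\<in>UNIV. \<Sum>b\<in>UNIV. W c a b y * Q c k y * Q b j y)"
      unfolding torsion[OF y] by (simp add: left_diff_distrib sum_subtractf)
    moreover have "N a y * ((\<Sum>b\<in>UNIV. om k a b y * Q b j y) - (\<Sum>b\<in>UNIV. om j a b y * Q b k y))
        = (\<Sum>c\<in>UNIV. \<Sum>b\<in>UNIV. W c a b y * Q c k y * Q b j y) - (\<Sum>c\<in>UNIV. \<Sum>b\<in>UNIV. W b a c y * Q c k y * Q b j y)"
      unfolding om_Q s using N_nz[OF y] by (simp add: right_diff_distrib)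
    ultimately show ?thesis by simp
  qed
  then have "N a y * ((dQ k a j y + (\<Sum>b\<in>UNIV. om k a b y * Q b j y)) - (dQ j a k y + (\<Sum>b\<in>UNIV. om j a b y * Q b k y))) = 0"
    by (simp add: algebra_simps)
  then show "(\<Sum>i\<in>UNIV. Q a i y * conn i k j y) = (\<Sum>i\<in>UNIV. Q a i y * conn i j k y)"
    unfolding Q_conn[OF y] using N_nz[OF y] by simp
qed

lemma N_om:
  assumes "y \<in> U"
  shows "N a y * om k a b y = (\<Sum>c\<in>UNIV. Q c k y * W c a b y)"
  using N_nz[OF assms] by (simp add: om_def sum_distrib_left)

text \<open>Covariant constancy of the metric comes down to \<open>compat\<close>: the symmetric
  part of \<open>W\<close> reproduces the derivative of \<open>N\<close>, while the derivatives of
  the coframe match by construction of \<open>conn\<close>.\<close>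

lemma g_deriv:
  assumes y: "y \<in> U"
  shows "partial_deriv l (\<lambda>y. g y $ i $ j) y =
    (\<Sum>e\<in>UNIV. g y $ e $ j * conn e l i y + g y $ i $ e * conn e l j y)"
proof -
  have half: "(\<Sum>e\<in>UNIV. g y $ i $ e * conn e l j y) =
      (\<Sum>a\<in>UNIV. N a y * Q a i y * dQ l a j y) + (\<Sum>a\<in>UNIV. \<Sum>b\<in>UNIV. (N a y * om l a b y) * Q a i y * Q b j y)" for i j
    unfolding g_contract[OF y] Q_conn[OF y]
    by (simp add: algebra_simps sum.distrib sum_distrib_left)
  have "partial_deriv l (\<lambda>y. g y $ i $ j) y = partial_deriv l (\<lambda>y. \<Sum>a\<in>UNIV. N a y * Q a i y * Q a j y) y"
    using open_U y g_eq by (rule partial_deriv_cong)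
  also have "\<dots> = (\<Sum>a\<in>UNIV. ((\<Sum>c\<in>UNIV. Q c l y * eN c a y) * Q a i y + N a y * dQ l a i y) * Q a j y + N a y * Q a i y * dQ l a j y)"
    by (intro has_partial_deriv_imp has_partial_deriv_intros N_deriv Q_deriv y)
  also have "\<dots> = (\<Sum>a\<in>UNIV. N a y * Q a j y * dQ l a i y) + (\<Sum>a\<in>UNIV. N a y * Q a i y * dQ l a j y)
      + (\<Sum>a\<in>UNIV. (\<Sum>c\<in>UNIV. Q c l y * eN c a y) * Q a i y * Q a j y)"
    by (simp add: algebra_simps sum.distrib)
  also have "(\<Sum>a\<in>UNIV. (\<Sum>c\<in>UNIV. Q c l y * eN c a y) * Q a i y * Q a j y)
      = (\<Sum>a\<in>UNIV. \<Sum>b\<in>UNIV. (N a y * om l a b y + N b y * om l b a y) * Q a i y * Q b j y)"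
  proof -
    have "N a y * om l a b y + N b y * om l b a y = (\<Sum>c\<in>UNIV. Q c l y * (if a = b then eN c a y else 0))" for a b
      unfolding N_om[OF y] sum.distrib[symmetric] distrib_left[symmetric] compat[OF y] ..
    also have "\<dots> a b = (if a = b then 1 else 0) * (\<Sum>c\<in>UNIV. Q c l y * eN c a y)" for a b
      by simp
    finally show ?thesis
      by (simp add: mult.assoc sum_delta_mult)
  qed
  also have "(\<Sum>a\<in>UNIV. \<Sum>b\<in>UNIV. (N a y * om l a b y + N b y * om l b a y) * Q a i y * Q b j y)
    = (\<Sum>a\<in>UNIV. \<Sum>b\<in>UNIV. (N a y * om l a b y) * Q a i y * Q b j y) + (\<Sum>a\<in>UNIV. \<Sum>b\<in>UNIV. (N a y * om l a b y) * Q a j y * Q b i y)"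
  proof -
    have "(\<Sum>a\<in>UNIV. \<Sum>b\<in>UNIV. (N b y * om l b a y) * Q a i y * Q b j y) = (\<Sum>a\<in>UNIV. \<Sum>b\<in>UNIV. (N a y * om l a b y) * Q a j y * Q b i y)"
      by (subst sum.swap) (simp add: mult.commute mult.left_commute)
    then show ?thesis by (simp add: distrib_right sum.distrib)
  qed
  also have "(\<Sum>a\<in>UNIV. N a y * Q a j y * dQ l a i y) + (\<Sum>a\<in>UNIV. N a y * Q a i y * dQ l a j y) + \<dots>
    = (\<Sum>e\<in>UNIV. g y $ j $ e * conn e l i y) + (\<Sum>e\<in>UNIV. g y $ i $ e * conn e l j y)"
    unfolding half by simp
  also have "\<dots> = (\<Sum>e\<in>UNIV. g y $ e $ j * conn e l i y + g y $ i $ e * conn e l j y)"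
    by (simp add: sum.distrib g_sym[OF y, of j])
  finally show ?thesis .
qed

lemma christoffel_eq:
  assumes y: "y \<in> U"
  shows "christoffel g y i k j = conn i k j y"
  by (intro christoffel_unique[where G = "\<lambda>i k j. conn i k j y"] inv_metric_mult g_sym conn_sym g_deriv y)

section \<open>Cartan's second structure equation\<close>

definition d_om :: "'n \<Rightarrow> 'n \<Rightarrow> 'n \<Rightarrow> 'n \<Rightarrow> real ^ 'n \<Rightarrow> real" where
  "d_om l k a b y = (\<Sum>c\<in>UNIV. dQ l c k y * (W c a b y / N a y) + Q c k y *
     (((\<Sum>d\<in>UNIV. Q d l y * eW d c a b y) * N a y - W c a b y * (\<Sum>d\<in>UNIV. Q d l y * eN d a y)) / (N a y * N a y)))"

text \<open>The curvature form d omega + omega wedge omega, evaluated on the coordinate vectors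
  \<open>k\<close> and \<open>l\<close>.\<close>

definition curv :: "'n \<Rightarrow> 'n \<Rightarrow> 'n \<Rightarrow> 'n \<Rightarrow> real ^ 'n \<Rightarrow> real" where
  "curv k l a b y = d_om k l a b y - d_om l k a b y
     + (\<Sum>e\<in>UNIV. om k a e y * om l e b y - om l a e y * om k e b y)"

lemma om_has_deriv: "y \<in> U \<Longrightarrow> has_partial_deriv (om k a b) l (d_om l k a b y) y"
  unfolding om_def[abs_def] d_om_def
  by (intro has_partial_deriv_intros Q_deriv W_deriv N_deriv N_nz)

lemma conn_deriv:
  assumes y: "y \<in> U"
  shows "has_partial_deriv (conn i k j) l (partial_deriv l (conn i k j) y) y"
proof -
  have "\<forall>a. \<exists>d. has_partial_deriv (P i a) l d y"
    using P_deriv[OF y] by blast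
  then obtain dP where dP: "\<And>a. has_partial_deriv (P i a) l (dP a) y"
    by metis
  have "has_partial_deriv (conn i k j) l
      (\<Sum>a\<in>UNIV. dP a * (dQ k a j y + (\<Sum>b\<in>UNIV. om k a b y * Q b j y))
         + P i a y * (ddQ l k a j y + (\<Sum>b\<in>UNIV. d_om l k a b y * Q b j y + om k a b y * dQ l b j y))) y"
    unfolding conn_def[abs_def]
    by (intro has_partial_deriv_intros dP Q_deriv dQ_deriv om_has_deriv y)
  then show ?thesis by (simp add: has_partial_deriv_imp)
qed

text \<open>The same function is differentiated twice, by the product rule and through
  \<open>Q_conn\<close>, and uniqueness equates the results. Contracting with \<open>Q\<close> keeps
  derivatives of \<open>P\<close> out of the formula.\<close>

lemma conn_deriv_Q:
  assumes y: "y \<in> U"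
  shows "(\<Sum>i\<in>UNIV. dQ l a i y * conn i k j y) + (\<Sum>i\<in>UNIV. Q a i y * partial_deriv l (conn i k j) y)
     = ddQ l k a j y + ((\<Sum>b\<in>UNIV. d_om l k a b y * Q b j y) + (\<Sum>b\<in>UNIV. om k a b y * dQ l b j y))"
proof -
  have "has_partial_deriv (\<lambda>y. \<Sum>i\<in>UNIV. Q a i y * conn i k j y) l
      (\<Sum>i\<in>UNIV. dQ l a i y * conn i k j y + Q a i y * partial_deriv l (conn i k j) y) y"
    by (intro has_partial_deriv_intros Q_deriv conn_deriv y)
  moreover have "has_partial_deriv (\<lambda>y. \<Sum>i\<in>UNIV. Q a i y * conn i k j y) l
      (ddQ l k a j y + (\<Sum>b\<in>UNIV. d_om l k a b y * Q b j y + om k a b y * dQ l b j y)) y"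
  proof (rule has_partial_deriv_cong[OF open_U y])
    show "has_partial_deriv (\<lambda>y. dQ k a j y + (\<Sum>b\<in>UNIV. om k a b y * Q b j y)) l
      (ddQ l k a j y + (\<Sum>b\<in>UNIV. d_om l k a b y * Q b j y + om k a b y * dQ l b j y)) y"
      by (intro has_partial_deriv_intros Q_deriv dQ_deriv om_has_deriv y)
  qed (simp add: Q_conn)
  ultimately show ?thesis
    using has_partial_deriv_unique unfolding sum.distrib by blast
qed

lemma riemann_up_eq:
  assumes y: "y \<in> U"
  shows "riemann_up g y i j k l = partial_deriv k (conn i l j) y - partial_deriv l (conn i k j) y
    + (\<Sum>e\<in>UNIV. conn i k e y * conn e l j y - conn i l e y * conn e k j y)"
proof -
  have "partial_deriv k (\<lambda>y. christoffel g y i l j) y = partial_deriv k (conn i l j) y" for k l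
    by (rule partial_deriv_cong[OF open_U y]) (rule christoffel_eq)
  then show ?thesis by (simp add: riemann_up_def christoffel_eq[OF y])
qed

lemma riemann_up_Q:
  assumes y: "y \<in> U"
  shows "(\<Sum>i\<in>UNIV. Q a i y * riemann_up g y i j k l) = (\<Sum>b\<in>UNIV. curv k l a b y * Q b j y)"
proof -
  define Qm where "Qm = (\<chi> a i. Q a i y)"
  define G where "G k = (\<chi> i j. conn i k j y)" for k
  define w where "w k = (\<chi> a b. om k a b y)" for k
  define dQm where "dQm k = (\<chi> a i. dQ k a i y)" for k
  define dG where "dG l k = (\<chi> i j. partial_deriv l (conn i k j) y)" for l k
  define dw where "dw l k = (\<chi> a b. d_om l k a b y)" for l k
  define dd where "dd l k = (\<chi> a i. ddQ l k a i y)" for l k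
  note defs = Qm_def G_def w_def dQm_def dG_def dw_def dd_def
  have 1: "Qm ** G k = dQm k + w k ** Qm" for k
    by (simp add: defs matrix_matrix_mult_def vec_eq_iff Q_conn[OF y])
  have 2: "dQm l ** G k + Qm ** dG l k = dd l k + (dw l k ** Qm + w k ** dQm l)" for l k
    by (simp add: defs matrix_matrix_mult_def vec_eq_iff conn_deriv_Q[OF y])
  have "dd l k = dd k l" for l k by (simp add: defs ddQ_sym[OF y, of l k])
  with 1 2 have "Qm ** (dG k l - dG l k + (G k ** G l - G l ** G k))
      = (dw k l - dw l k + (w k ** w l - w l ** w k)) ** Qm"
    by (intro cartan_structure_matrix[where ddQ = "dd k l"]) auto
  then have "(Qm ** (dG k l - dG l k + (G k ** G l - G l ** G k))) $ a $ j
      = ((dw k l - dw l k + (w k ** w l - w l ** w k)) ** Qm) $ a $ j" by simp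
  then show ?thesis
    by (simp add: defs matrix_matrix_mult_def riemann_up_eq[OF y] curv_def sum_subtractf)
qed

lemma N_d_om:
  assumes y: "y \<in> U"
  shows "N a y * d_om l k a b y = (\<Sum>c\<in>UNIV. dQ l c k y * W c a b y)
    + (\<Sum>c\<in>UNIV. \<Sum>d\<in>UNIV. Q c k y * Q d l y * (eW d c a b y - W c a b y * eN d a y / N a y))"
proof -
  have "N a y * d_om l k a b y = (\<Sum>c\<in>UNIV. dQ l c k y * W c a b y + Q c k y *
     ((\<Sum>d\<in>UNIV. Q d l y * eW d c a b y) - W c a b y / N a y * (\<Sum>d\<in>UNIV. Q d l y * eN d a y)))"
  proof -
    have "n * (q * (v / n) + p * ((x * n - v * z) / (n * n))) = q * v + p * (x - v / n * z)" if "n \<noteq> 0"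
      for n q v p x z :: real
      using that by (simp add: field_simps)
    then show ?thesis
      using N_nz[OF y, of a] unfolding d_om_def sum_distrib_left[of "N a y"] by simp
  qed
  then show ?thesis
    by (simp add: sum.distrib sum_distrib_left right_diff_distrib sum_subtractf mult_ac)
qed

lemma curv_frame:
  assumes y: "y \<in> U"
  shows "N a y * curv k l a b y = (\<Sum>c\<in>UNIV. Q c k y * (\<Sum>d\<in>UNIV. Q d l y * frame_riemann a b c d y))"
proof -
  note nz = N_nz[OF y]
  have "N a y * curv k l a b y = ((\<Sum>f\<in>UNIV. dQ k f l y * W f a b y) - (\<Sum>f\<in>UNIV. dQ l f k y * W f a b y))
    + ((\<Sum>c\<in>UNIV. \<Sum>d\<in>UNIV. Q c l y * Q d k y * (eW d c a b y - W c a b y * eN d a y / N a y))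
     - (\<Sum>c\<in>UNIV. \<Sum>d\<in>UNIV. Q c k y * Q d l y * (eW d c a b y - W c a b y * eN d a y / N a y)))
    + (\<Sum>e\<in>UNIV. (N a y * om k a e y) * (N e y * om l e b y) / N e y - (N a y * om l a e y) * (N e y * om k e b y) / N e y)"
  proof -
    have "N a y * (\<Sum>e\<in>UNIV. om k a e y * om l e b y - om l a e y * om k e b y)
      = (\<Sum>e\<in>UNIV. (N a y * om k a e y) * (N e y * om l e b y) / N e y - (N a y * om l a e y) * (N e y * om k e b y) / N e y)"
      unfolding sum_distrib_left using nz by (intro sum.cong refl) (simp add: right_diff_distrib)
    moreover have "N a y * curv k l a b y = N a y * d_om k l a b y - N a y * d_om l k a b y
        + N a y * (\<Sum>e\<in>UNIV. om k a e y * om l e b y - om l a e y * om k e b y)"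
      by (simp add: curv_def distrib_left right_diff_distrib)
    ultimately show ?thesis
      unfolding N_d_om[OF y] by simp
  qed
  \<comment> \<open>Coframe derivatives survive only antisymmetrised, so \<open>torsion\<close>
    turns them into products of connection coefficients: the commutator term of
    \<open>frame_riemann\<close>.\<close>
  also have "(\<Sum>f\<in>UNIV. dQ k f l y * W f a b y) - (\<Sum>f\<in>UNIV. dQ l f k y * W f a b y)
    = (\<Sum>f\<in>UNIV. (N f y * (dQ k f l y - dQ l f k y)) * (W f a b y / N f y))"
    unfolding sum_subtractf[symmetric] using nz by (intro sum.cong refl) (simp add: field_simps)
  also have "\<dots> = (\<Sum>c\<in>UNIV. \<Sum>d\<in>UNIV. Q c k y * Q d l y * (\<Sum>f\<in>UNIV. (W d f c y - W c f d y) * W f a b y / N f y))"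
  proof -
    have "(\<Sum>f\<in>UNIV. (N f y * (dQ k f l y - dQ l f k y)) * (W f a b y / N f y)) =
       (\<Sum>f\<in>UNIV. \<Sum>c\<in>UNIV. \<Sum>d\<in>UNIV. Q c k y * Q d l y * ((W d f c y - W c f d y) * W f a b y / N f y))"
      unfolding torsion[OF y] sum_distrib_right by (simp add: mult_ac)
    also have "\<dots> = (\<Sum>c\<in>UNIV. \<Sum>f\<in>UNIV. \<Sum>d\<in>UNIV. Q c k y * Q d l y * ((W d f c y - W c f d y) * W f a b y / N f y))"
      by (rule sum.swap)
    also have "\<dots> = (\<Sum>c\<in>UNIV. \<Sum>d\<in>UNIV. \<Sum>f\<in>UNIV. Q c k y * Q d l y * ((W d f c y - W c f d y) * W f a b y / N f y))"
      by (intro sum.cong refl sum.swap)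
    finally show ?thesis by (simp add: sum_distrib_left)
  qed
  also have "(\<Sum>c\<in>UNIV. \<Sum>d\<in>UNIV. Q c l y * Q d k y * (eW d c a b y - W c a b y * eN d a y / N a y))
      = (\<Sum>c\<in>UNIV. \<Sum>d\<in>UNIV. Q c k y * Q d l y * (eW c d a b y - W d a b y * eN c a y / N a y))"
    by (subst sum.swap) (simp add: mult_ac)
  also have "(\<Sum>e\<in>UNIV. (N a y * om k a e y) * (N e y * om l e b y) / N e y - (N a y * om l a e y) * (N e y * om k e b y) / N e y)
    = (\<Sum>c\<in>UNIV. \<Sum>d\<in>UNIV. Q c k y * Q d l y * (\<Sum>e\<in>UNIV. (W c a e y * W d e b y - W d a e y * W c e b y) / N e y))"
  proof -
    have s: "(\<Sum>e\<in>UNIV. (N a y * om k a e y) * (N e y * om l e b y) / N e y)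
       = (\<Sum>c\<in>UNIV. \<Sum>d\<in>UNIV. Q c k y * Q d l y * (\<Sum>e\<in>UNIV. W c a e y * W d e b y / N e y))" for k l
    proof -
      have "(\<Sum>e\<in>UNIV. (N a y * om k a e y) * (N e y * om l e b y) / N e y)
        = (\<Sum>e\<in>UNIV. \<Sum>c\<in>UNIV. \<Sum>d\<in>UNIV. Q c k y * Q d l y * (W c a e y * W d e b y / N e y))"
        unfolding N_om[OF y] sum_product sum_divide_distrib by (simp add: mult_ac)
      also have "\<dots> = (\<Sum>c\<in>UNIV. \<Sum>e\<in>UNIV. \<Sum>d\<in>UNIV. Q c k y * Q d l y * (W c a e y * W d e b y / N e y))"
        by (rule sum.swap)
      also have "\<dots> = (\<Sum>c\<in>UNIV. \<Sum>d\<in>UNIV. \<Sum>e\<in>UNIV. Q c k y * Q d l y * (W c a e y * W d e b y / N e y))"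
        by (intro sum.cong refl sum.swap)
      finally show ?thesis by (simp add: sum_distrib_left)
    qed
    have t: "(\<Sum>c\<in>UNIV. \<Sum>d\<in>UNIV. Q c l y * Q d k y * (\<Sum>e\<in>UNIV. W c a e y * W d e b y / N e y))
       = (\<Sum>c\<in>UNIV. \<Sum>d\<in>UNIV. Q c k y * Q d l y * (\<Sum>e\<in>UNIV. W d a e y * W c e b y / N e y))"
      by (subst sum.swap) (simp add: mult_ac)
    show ?thesis
      unfolding sum_subtractf s[of k l] s[of l k] t
      by (simp add: sum_subtractf right_diff_distrib diff_divide_distrib)
  qed
  also have "(\<Sum>c\<in>UNIV. \<Sum>d\<in>UNIV. Q c k y * Q d l y * (\<Sum>f\<in>UNIV. (W d f c y - W c f d y) * W f a b y / N f y))
      + ((\<Sum>c\<in>UNIV. \<Sum>d\<in>UNIV. Q c k y * Q d l y * (eW c d a b y - W d a b y * eN c a y / N a y))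
       - (\<Sum>c\<in>UNIV. \<Sum>d\<in>UNIV. Q c k y * Q d l y * (eW d c a b y - W c a b y * eN d a y / N a y))) + \<dots>
     = (\<Sum>c\<in>UNIV. \<Sum>d\<in>UNIV. Q c k y * Q d l y * frame_riemann a b c d y)"
  proof -
    have "(\<Sum>e\<in>UNIV. (W c a e y * W d e b y - W d a e y * W c e b y) / N e y)
       = (W d a b y * eN c a y - W c a b y * eN d a y) / N a y
         - (\<Sum>e\<in>UNIV. (W c e a y * W d e b y - W d e a y * W c e b y) / N e y)" for c d
    proof -
      \<comment> \<open>Exchanging the lowered indices by \<open>compat\<close> leaves a diagonal
        term in \<open>eN\<close>; it cancels what the derivative of \<open>1 / N\<close>
        contributed in \<open>N_d_om\<close>.\<close>
      have W: "W c a e y = (if a = e then 1 else 0) * eN c a y - W c e a y" for c e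
        using compat[OF y, of c a e] by auto
      have "(\<Sum>e\<in>UNIV. (W c a e y * W d e b y - W d a e y * W c e b y) / N e y)
        = (\<Sum>e\<in>UNIV. (if a = e then 1 else 0) * ((W d e b y * eN c a y - W c e b y * eN d a y) / N e y)
           - (W c e a y * W d e b y - W d e a y * W c e b y) / N e y)"
        unfolding W[of c] W[of d]
        by (intro sum.cong refl) (auto simp: diff_divide_distrib add_divide_distrib algebra_simps)
      then show ?thesis by (simp only: sum_subtractf sum_delta_mult)
    qed
    then show ?thesis
      unfolding sum.distrib[symmetric] sum_subtractf[symmetric] distrib_left[symmetric] right_diff_distrib[symmetric]
      by (intro sum.cong refl) (simp add: frame_riemann_def diff_divide_distrib)
  qed
  finally show ?thesis by (simp add: sum_distrib_left mult.assoc)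
qed

lemma riemann_frame:
  assumes y: "y \<in> U"
  shows "riemann g y i j k l = (\<Sum>a\<in>UNIV. Q a i y * (\<Sum>b\<in>UNIV. Q b j y *
     (\<Sum>c\<in>UNIV. Q c k y * (\<Sum>d\<in>UNIV. Q d l y * frame_riemann a b c d y))))"
proof -
  have "riemann g y i j k l = (\<Sum>a\<in>UNIV. Q a i y * (\<Sum>b\<in>UNIV. Q b j y * (N a y * curv k l a b y)))"
    unfolding riemann_def g_contract[OF y] riemann_up_Q[OF y]
    by (simp add: sum_distrib_left mult_ac)
  then show ?thesis unfolding curv_frame[OF y] .
qed

lemma ricci_frame:
  assumes y: "y \<in> U"
  shows "ricci g y j l = (\<Sum>b\<in>UNIV. Q b j y * (\<Sum>d\<in>UNIV. Q d l y * (\<Sum>a\<in>UNIV. frame_riemann a b a d y / N a y)))"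
proof -
  define Y where "Y a c = (\<Sum>b\<in>UNIV. Q b j y * (\<Sum>d\<in>UNIV. Q d l y * (frame_riemann a b c d y / N a y)))" for a c
  have cv: "curv k l a b y = (\<Sum>c\<in>UNIV. Q c k y * (\<Sum>d\<in>UNIV. Q d l y * (frame_riemann a b c d y / N a y)))" for k a b
  proof -
    have "curv k l a b y = N a y * curv k l a b y / N a y" using N_nz[OF y] by simp
    then show ?thesis unfolding curv_frame[OF y] by (simp add: sum_divide_distrib sum_distrib_left)
  qed
  have up: "riemann_up g y i j k l = (\<Sum>a\<in>UNIV. P i a y * (\<Sum>c\<in>UNIV. Q c k y * Y a c))" for i k
  proof -
    have "(\<Sum>b\<in>UNIV. curv k l a b y * Q b j y) = (\<Sum>c\<in>UNIV. Q c k y * Y a c)" for a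
      unfolding cv Y_def sum_distrib_left sum_distrib_right
      by (subst sum.swap) (simp add: mult_ac)
    then show ?thesis
      using coframe_contract[OF y, of i "\<lambda>i. riemann_up g y i j k l"] by (simp add: riemann_up_Q[OF y])
  qed
  have "ricci g y j l = (\<Sum>i\<in>UNIV. \<Sum>a\<in>UNIV. \<Sum>c\<in>UNIV. Q c i y * P i a y * Y a c)"
    unfolding ricci_def up by (simp add: sum_distrib_left mult_ac)
  also have "\<dots> = (\<Sum>a\<in>UNIV. \<Sum>i\<in>UNIV. \<Sum>c\<in>UNIV. Q c i y * P i a y * Y a c)"
    by (rule sum.swap)
  also have "\<dots> = (\<Sum>a\<in>UNIV. \<Sum>c\<in>UNIV. (\<Sum>i\<in>UNIV. Q c i y * P i a y) * Y a c)"
    unfolding sum_distrib_right by (intro sum.cong refl sum.swap)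
  also have "\<dots> = (\<Sum>a\<in>UNIV. Y a a)"
    unfolding QP[OF y] sum_delta_mult ..
  also have "\<dots> = (\<Sum>b\<in>UNIV. Q b j y * (\<Sum>d\<in>UNIV. Q d l y * (\<Sum>a\<in>UNIV. frame_riemann a b a d y / N a y)))"
  proof -
    have "(\<Sum>a\<in>UNIV. Y a a) = (\<Sum>a\<in>UNIV. \<Sum>b\<in>UNIV. \<Sum>d\<in>UNIV. Q b j y * Q d l y * (frame_riemann a b a d y / N a y))"
      unfolding Y_def by (simp add: sum_distrib_left mult_ac)
    also have "\<dots> = (\<Sum>b\<in>UNIV. \<Sum>a\<in>UNIV. \<Sum>d\<in>UNIV. Q b j y * Q d l y * (frame_riemann a b a d y / N a y))"
      by (rule sum.swap)
    also have "\<dots> = (\<Sum>b\<in>UNIV. \<Sum>d\<in>UNIV. \<Sum>a\<in>UNIV. Q b j y * Q d l y * (frame_riemann a b a d y / N a y))"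
      by (intro sum.cong refl sum.swap)
    finally show ?thesis by (simp add: sum_distrib_left mult_ac)
  qed
  finally show ?thesis .
qed

text \<open>In the dual frame the inverse metric is diagonal with entries \<open>1 / N\<close>. This
  serves both for the square of the Weyl tensor and for the norm of the gradient of that
  square.\<close>

lemma inv_metric_pair:
  assumes y: "y \<in> U"
  shows "(\<Sum>i\<in>UNIV. \<Sum>p\<in>UNIV. inv_metric g y $ i $ p * ((\<Sum>a\<in>UNIV. Q a i y * X a) * (\<Sum>a\<in>UNIV. Q a p y * Z a)))
     = (\<Sum>a\<in>UNIV. X a * Z a / N a y)"
proof -
  have l: "(\<Sum>p\<in>UNIV. inv_metric g y $ i $ p * (\<Sum>a\<in>UNIV. Q a p y * Z a)) = (\<Sum>a\<in>UNIV. P i a y * (Z a / N a y))" for i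
  proof -
    have Pf: "(\<Sum>p\<in>UNIV. P p b y * (\<Sum>a\<in>UNIV. Q a p y * Z a)) = Z b" for b
    proof -
      have "(\<Sum>p\<in>UNIV. P p b y * (\<Sum>a\<in>UNIV. Q a p y * Z a)) = (\<Sum>a\<in>UNIV. (\<Sum>p\<in>UNIV. Q a p y * P p b y) * Z a)"
        unfolding sum_distrib_left sum_distrib_right by (subst sum.swap) (simp add: mult_ac)
      then show ?thesis unfolding QP[OF y] sum_delta_mult .
    qed
    have "(\<Sum>p\<in>UNIV. inv_metric g y $ i $ p * (\<Sum>a\<in>UNIV. Q a p y * Z a))
      = (\<Sum>p\<in>UNIV. \<Sum>b\<in>UNIV. P i b y / N b y * (P p b y * (\<Sum>a\<in>UNIV. Q a p y * Z a)))"
      unfolding inv_metric_eq[OF y] sum_distrib_right by (simp add: mult_ac)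
    also have "\<dots> = (\<Sum>b\<in>UNIV. P i b y / N b y * (\<Sum>p\<in>UNIV. P p b y * (\<Sum>a\<in>UNIV. Q a p y * Z a)))"
      unfolding sum_distrib_left by (rule sum.swap)
    finally show ?thesis unfolding Pf by simp
  qed
  have "(\<Sum>i\<in>UNIV. \<Sum>p\<in>UNIV. inv_metric g y $ i $ p * ((\<Sum>a\<in>UNIV. Q a i y * X a) * (\<Sum>a\<in>UNIV. Q a p y * Z a)))
     = (\<Sum>i\<in>UNIV. (\<Sum>a\<in>UNIV. Q a i y * X a) * (\<Sum>p\<in>UNIV. inv_metric g y $ i $ p * (\<Sum>a\<in>UNIV. Q a p y * Z a)))"
    by (simp add: sum_distrib_left mult_ac)
  also have "\<dots> = (\<Sum>i\<in>UNIV. \<Sum>a\<in>UNIV. X a * (Q a i y * (\<Sum>b\<in>UNIV. P i b y * (Z b / N b y))))"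
    unfolding l by (simp add: sum_distrib_right mult_ac)
  also have "\<dots> = (\<Sum>a\<in>UNIV. X a * (\<Sum>i\<in>UNIV. Q a i y * (\<Sum>b\<in>UNIV. P i b y * (Z b / N b y))))"
    unfolding sum_distrib_left by (rule sum.swap)
  finally show ?thesis unfolding frame_contract[OF y] by simp
qed

section \<open>Einstein metrics: constant curvature plus a trace-free part\<close>

context
  fixes y :: "real ^ 'n" and C :: "'n \<Rightarrow> 'n \<Rightarrow> 'n \<Rightarrow> 'n \<Rightarrow> real" and \<kappa> :: real
  assumes y: "y \<in> U"
    and dim: "CARD('n) \<ge> 3"
    and riem: "\<And>a b c d. frame_riemann a b c d y = C a b c d
      + \<kappa> * (N a y * N b y * ((if a = c then 1 else 0) * (if b = d then 1 else 0)
          - (if a = d then 1 else 0) * (if b = c then 1 else 0)))"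
    and trace: "\<And>b d. (\<Sum>a\<in>UNIV. C a b a d / N a y) = 0"
begin

lemma einstein_ricci: "ricci g y j l = (real CARD('n) - 1) * \<kappa> * g y $ j $ l"
proof -
  have t: "(\<Sum>a\<in>UNIV. frame_riemann a b a d y / N a y) = (if b = d then 1 else 0) * ((real CARD('n) - 1) * \<kappa> * N b y)" for b d
  proof -
    \<comment> \<open>For \<open>b = d\<close> every \<open>a\<close> contributes the same amount
      except \<open>a = b\<close>, where the two products of deltas cancel; this is the source of
      the factor n - 1.\<close>
    have "(\<Sum>a\<in>UNIV. frame_riemann a b a d y / N a y) = (\<Sum>a\<in>UNIV. C a b a d / N a y)
      + (\<Sum>a\<in>UNIV. \<kappa> * N b y * (if b = d then 1 else 0) - (if a = b then 1 else 0) * (\<kappa> * N b y * (if b = d then 1 else 0)))"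
      unfolding sum.distrib[symmetric] riem
      by (intro sum.cong refl) (use N_nz[OF y] in \<open>auto simp: add_divide_distrib\<close>)
    then show ?thesis
      unfolding trace sum_subtractf sum_delta_mult by (simp add: algebra_simps)
  qed
  have "ricci g y j l = (\<Sum>b\<in>UNIV. Q b j y * (\<Sum>d\<in>UNIV. (if b = d then 1 else 0) * (Q d l y * ((real CARD('n) - 1) * \<kappa> * N b y))))"
    unfolding ricci_frame[OF y] t by (simp only: mult.left_commute)
  then show ?thesis
    unfolding sum_delta_mult g_eq[OF y] by (simp add: sum_distrib_left mult_ac)
qed

text \<open>By \<open>einstein_ricci\<close> the correction in \<open>weyl_einstein\<close> has
  coefficient exactly \<kappa>, so it removes the constant-curvature part and leaves
  \<open>C\<close>.\<close>

lemma einstein_weyl: "weyl g y i j k l = (\<Sum>a\<in>UNIV. Q a i y * (\<Sum>b\<in>UNIV. Q b j y *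
     (\<Sum>c\<in>UNIV. Q c k y * (\<Sum>d\<in>UNIV. Q d l y * C a b c d))))"
proof -
  have g2: "g y $ i $ k * g y $ j $ l = (\<Sum>a\<in>UNIV. Q a i y * (\<Sum>b\<in>UNIV. Q b j y *
     (\<Sum>c\<in>UNIV. Q c k y * (\<Sum>d\<in>UNIV. Q d l y * (N a y * N b y * ((if a = c then 1 else 0) * (if b = d then 1 else 0)))))))" for i j k l
  proof -
    have "(\<Sum>d\<in>UNIV. Q d l y * (N a y * N b y * ((if a = c then 1 else 0) * (if b = d then 1 else 0))))
       = (if a = c then 1 else 0) * (Q b l y * N a y * N b y)" for a b c
    proof -
      have "(\<Sum>d\<in>UNIV. Q d l y * (N a y * N b y * ((if a = c then 1 else 0) * (if b = d then 1 else 0))))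
       = (\<Sum>d\<in>UNIV. (if b = d then 1 else 0) * (Q d l y * (N a y * N b y * (if a = c then 1 else 0))))"
        by (simp only: mult_ac)
      then show ?thesis unfolding sum_delta_mult by (simp only: mult_ac)
    qed
    then have "(\<Sum>a\<in>UNIV. Q a i y * (\<Sum>b\<in>UNIV. Q b j y *
       (\<Sum>c\<in>UNIV. Q c k y * (\<Sum>d\<in>UNIV. Q d l y * (N a y * N b y * ((if a = c then 1 else 0) * (if b = d then 1 else 0)))))))
      = (\<Sum>a\<in>UNIV. Q a i y * (\<Sum>b\<in>UNIV. Q b j y * (\<Sum>c\<in>UNIV. (if a = c then 1 else 0) * (Q c k y * (Q b l y * N a y * N b y)))))"
      by (simp only: mult.left_commute)
    then show ?thesis
      unfolding sum_delta_mult g_eq[OF y] sum_product by (simp add: sum_distrib_left mult_ac)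
  qed
  have g2': "g y $ i $ l * g y $ j $ k = (\<Sum>a\<in>UNIV. Q a i y * (\<Sum>b\<in>UNIV. Q b j y *
     (\<Sum>c\<in>UNIV. Q c k y * (\<Sum>d\<in>UNIV. Q d l y * (N a y * N b y * ((if a = d then 1 else 0) * (if b = c then 1 else 0)))))))"
  proof -
    have "(\<Sum>c\<in>UNIV. Q c k y * (\<Sum>d\<in>UNIV. Q d l y * (N a y * N b y * ((if a = d then 1 else 0) * (if b = c then 1 else 0)))))
      = (\<Sum>c\<in>UNIV. Q c l y * (\<Sum>d\<in>UNIV. Q d k y * (N a y * N b y * ((if a = c then 1 else 0) * (if b = d then 1 else 0)))))" for a b
      unfolding sum_distrib_left by (subst sum.swap) (simp only: mult.left_commute)
    then show ?thesis unfolding g2[of i l j k] by simp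
  qed
  have "riemann g y i j k l = (\<Sum>a\<in>UNIV. Q a i y * (\<Sum>b\<in>UNIV. Q b j y *
     (\<Sum>c\<in>UNIV. Q c k y * (\<Sum>d\<in>UNIV. Q d l y * C a b c d))))
     + \<kappa> * (g y $ i $ k * g y $ j $ l - g y $ i $ l * g y $ j $ k)"
    unfolding riemann_frame[OF y] riem g2' g2[of i k j l]
    by (simp add: distrib_left sum.distrib right_diff_distrib sum_subtractf sum_distrib_left mult.left_commute[of \<kappa>])
  moreover have "weyl g y i j k l = riemann g y i j k l
     - ((real CARD('n) - 1) * \<kappa>) / (real CARD('n) - 1) * (g y $ i $ k * g y $ j $ l - g y $ i $ l * g y $ j $ k)"
    by (intro weyl_einstein inv_metric_mult g_sym einstein_ricci dim y)
  ultimately show ?thesis using dim by simp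
qed

lemma einstein_weyl_square:
  "weyl_square g y = (\<Sum>a\<in>UNIV. \<Sum>b\<in>UNIV. \<Sum>c\<in>UNIV. \<Sum>d\<in>UNIV. (C a b c d)\<^sup>2 / (N a y * N b y * N c y * N d y))"
proof -
  \<comment> \<open>\<open>C3\<close>, \<open>C2\<close> and \<open>C1\<close> are \<open>C\<close>
    with the last one, two and three slots converted to coordinate indices.\<close>
  define C3 where "C3 l a b c = (\<Sum>d\<in>UNIV. Q d l y * C a b c d)" for l a b c
  define C2 where "C2 k l a b = (\<Sum>c\<in>UNIV. Q c k y * C3 l a b c)" for k l a b
  define C1 where "C1 j k l a = (\<Sum>b\<in>UNIV. Q b j y * C2 k l a b)" for j k l a
  have w: "weyl g y i j k l = (\<Sum>a\<in>UNIV. Q a i y * C1 j k l a)" for i j k l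
    unfolding einstein_weyl C1_def C2_def C3_def ..
  let ?h = "\<lambda>i p. inv_metric g y $ i $ p"
  have "weyl_square g y = (\<Sum>i\<in>UNIV. \<Sum>j\<in>UNIV. \<Sum>k\<in>UNIV. \<Sum>l\<in>UNIV. \<Sum>p\<in>UNIV. \<Sum>q\<in>UNIV. \<Sum>r\<in>UNIV. \<Sum>s\<in>UNIV.
      ?h l s * (?h k r * (?h j q * (?h i p * (weyl g y i j k l * weyl g y p q r s)))))"
    unfolding weyl_square_def weyl_upper_def by (simp add: sum_distrib_left mult_ac)
  \<comment> \<open>Each index is placed next to its raised partner, the first pair innermost, so
    that \<open>inv_metric_pair\<close> can contract the four pairs from the inside
    outwards.\<close>
  also have "\<dots> = (\<Sum>l\<in>UNIV. \<Sum>s\<in>UNIV. \<Sum>k\<in>UNIV. \<Sum>r\<in>UNIV. \<Sum>j\<in>UNIV. \<Sum>q\<in>UNIV. \<Sum>i\<in>UNIV. \<Sum>p\<in>UNIV.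
      ?h l s * (?h k r * (?h j q * (?h i p * (weyl g y i j k l * weyl g y p q r s)))))"
    by (simp only: sum.cartesian_product)
      (rule sum.reindex_bij_witness[of _ "\<lambda>(l,s,k,r,j,q,i,p). (i,j,k,l,p,q,r,s)" "\<lambda>(i,j,k,l,p,q,r,s). (l,s,k,r,j,q,i,p)"]; auto)
  also have "\<dots> = (\<Sum>l\<in>UNIV. \<Sum>s\<in>UNIV. ?h l s * (\<Sum>k\<in>UNIV. \<Sum>r\<in>UNIV. ?h k r * (\<Sum>j\<in>UNIV. \<Sum>q\<in>UNIV. ?h j q *
      (\<Sum>i\<in>UNIV. \<Sum>p\<in>UNIV. ?h i p * (weyl g y i j k l * weyl g y p q r s)))))"
    by (simp only: sum_distrib_left)
  also have "\<dots> = (\<Sum>l\<in>UNIV. \<Sum>s\<in>UNIV. ?h l s * (\<Sum>k\<in>UNIV. \<Sum>r\<in>UNIV. ?h k r * (\<Sum>j\<in>UNIV. \<Sum>q\<in>UNIV. ?h j q *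
      (\<Sum>a\<in>UNIV. C1 j k l a * C1 q r s a / N a y))))"
    unfolding w inv_metric_pair[OF y] ..
  also have "\<dots> = (\<Sum>l\<in>UNIV. \<Sum>s\<in>UNIV. ?h l s * (\<Sum>k\<in>UNIV. \<Sum>r\<in>UNIV. ?h k r *
      (\<Sum>a\<in>UNIV. (\<Sum>b\<in>UNIV. C2 k l a b * C2 r s a b / N b y) / N a y)))"
    unfolding sum_pair_swap C1_def inv_metric_pair[OF y] ..
  also have "\<dots> = (\<Sum>l\<in>UNIV. \<Sum>s\<in>UNIV. ?h l s *
      (\<Sum>a\<in>UNIV. (\<Sum>b\<in>UNIV. (\<Sum>c\<in>UNIV. C3 l a b c * C3 s a b c / N c y) / N b y) / N a y))"
    unfolding sum_pair_swap C2_def inv_metric_pair[OF y] ..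
  also have "\<dots> =
      (\<Sum>a\<in>UNIV. (\<Sum>b\<in>UNIV. (\<Sum>c\<in>UNIV. (\<Sum>d\<in>UNIV. C a b c d * C a b c d / N d y) / N c y) / N b y) / N a y)"
    unfolding sum_pair_swap C3_def inv_metric_pair[OF y] ..
  also have "\<dots> = (\<Sum>a\<in>UNIV. \<Sum>b\<in>UNIV. \<Sum>c\<in>UNIV. \<Sum>d\<in>UNIV. (C a b c d)\<^sup>2 / (N a y * N b y * N c y * N d y))"
    by (simp add: sum_divide_distrib power2_eq_square mult_ac)
  finally show ?thesis .
qed

end

end

section \<open>The Carter frame of the Kerr-(anti-)de Sitter metric\<close>

lemma has_partial_deriv_r_theta:
  fixes y :: "real ^ 4"
  assumes "((\<lambda>r. F r (y $ 3)) has_real_derivative Fr) (at (y $ 2))"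
    and "((\<lambda>\<theta>. F (y $ 2) \<theta>) has_real_derivative Ft) (at (y $ 3))"
  shows "has_partial_deriv (\<lambda>y. F (y $ 2) (y $ 3)) k (if k = 2 then Fr else if k = 3 then Ft else 0) y"
proof -
  have "((\<lambda>s. F (y $ 2 + s) (y $ 3)) has_real_derivative Fr) (at 0)"
    "((\<lambda>s. F (y $ 2) (y $ 3 + s)) has_real_derivative Ft) (at 0)"
    using assms DERIV_shift[of "\<lambda>r. F r (y $ 3)" Fr 0 "y $ 2"] DERIV_shift[of "\<lambda>\<theta>. F (y $ 2) \<theta>" Ft 0 "y $ 3"]
    by (simp_all add: add.commute)
  then show ?thesis
    unfolding has_partial_deriv_def using exhaust_4[of k] by (auto simp: axis_def)
qed

lemma vector_4 [simp]:
  "(vector [w, x, y, z] :: 'a::zero ^ 4) $ 1 = w"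
  "(vector [w, x, y, z] :: 'a::zero ^ 4) $ 2 = x"
  "(vector [w, x, y, z] :: 'a::zero ^ 4) $ 3 = y"
  "(vector [w, x, y, z] :: 'a::zero ^ 4) $ 4 = z"
  by (simp_all add: vector_def)

text \<open>Compatibility with a diagonal metric makes the symmetric part of each connection matrix
  diagonal, so ten entries determine it.\<close>

definition skew_plus_diag :: "real \<Rightarrow> real \<Rightarrow> real \<Rightarrow> real \<Rightarrow> real \<Rightarrow> real \<Rightarrow> real \<Rightarrow> real \<Rightarrow> real \<Rightarrow> real \<Rightarrow> real ^ 4 ^ 4" where
  "skew_plus_diag d1 d2 d3 d4 x12 x13 x14 x23 x24 x34 = vector
    [vector [d1, x12, x13, x14], vector [- x12, d2, x23, x24],
     vector [- x13, - x23, d3, x34], vector [- x14, - x24, - x34, d4]]"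

lemma skew_plus_diag_deriv:
  assumes "(d1 has_real_derivative d1') (at t)" "(d2 has_real_derivative d2') (at t)" "(d3 has_real_derivative d3') (at t)"
    "(d4 has_real_derivative d4') (at t)" "(x12 has_real_derivative x12') (at t)" "(x13 has_real_derivative x13') (at t)"
    "(x14 has_real_derivative x14') (at t)" "(x23 has_real_derivative x23') (at t)" "(x24 has_real_derivative x24') (at t)"
    "(x34 has_real_derivative x34') (at t)"
  shows "((\<lambda>z. skew_plus_diag (d1 z) (d2 z) (d3 z) (d4 z) (x12 z) (x13 z) (x14 z) (x23 z) (x24 z) (x34 z) $ a $ b) has_real_derivative
     skew_plus_diag d1' d2' d3' d4' x12' x13' x14' x23' x24' x34' $ a $ b) (at t)"
proof -
  have "\<forall>a b. ((\<lambda>z. skew_plus_diag (d1 z) (d2 z) (d3 z) (d4 z) (x12 z) (x13 z) (x14 z) (x23 z) (x24 z) (x34 z) $ a $ b) has_real_derivative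
     skew_plus_diag d1' d2' d3' d4' x12' x13' x14' x23' x24' x34' $ a $ b) (at t)"
    unfolding forall_4 skew_plus_diag_def using assms by (auto intro: DERIV_minus)
  then show ?thesis by blast
qed

text \<open>Real representatives, because numerals of the type \<open>4\<close> are residues modulo
  4.\<close>

definition index_number :: "4 \<Rightarrow> real" where "index_number i = vector [1, 2, 3, 4] $ i"

text \<open>The Vandermonde product of four distinct indices from 1 to 4 is 12 times the sign of the
  permutation.\<close>

definition levi_civita :: "4 \<Rightarrow> 4 \<Rightarrow> 4 \<Rightarrow> 4 \<Rightarrow> real" where
  "levi_civita i j k l = (index_number j - index_number i) * (index_number k - index_number i) * (index_number l - index_number i)
     * (index_number k - index_number j) * (index_number l - index_number j) * (index_number l - index_number k) / 12"

definition plane_weight :: "real ^ 4 ^ 4" where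
  "plane_weight = vector [vector [0, 2, -1, -1], vector [2, 0, -1, -1], vector [-1, -1, 0, 2], vector [-1, -1, 2, 0]]"

locale kerr_ds =
  fixes a m \<Lambda> :: real
begin

definition S :: "real \<Rightarrow> real \<Rightarrow> real" where "S r u = r\<^sup>2 + a\<^sup>2 * u\<^sup>2"
definition D :: "real \<Rightarrow> real" where "D r = (1 - \<Lambda> / 3 * r\<^sup>2) * (r\<^sup>2 + a\<^sup>2) - 2 * m * r"
definition D1 :: "real \<Rightarrow> real" where "D1 r = 2 * r - 2 * \<Lambda> / 3 * r * (2 * r\<^sup>2 + a\<^sup>2) - 2 * m"
definition D2 :: "real \<Rightarrow> real" where "D2 r = 2 - 2 * \<Lambda> / 3 * (6 * r\<^sup>2 + a\<^sup>2)"
text \<open>This is Delta_theta sin^2 theta in terms of u = cos theta; the coefficient of du^2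
  becomes S / H and the metric rational.\<close>

definition H :: "real \<Rightarrow> real" where "H u = (1 + a\<^sup>2 * \<Lambda> / 3 * u\<^sup>2) * (1 - u\<^sup>2)"
definition H1 :: "real \<Rightarrow> real" where "H1 u = 2 * u * (a\<^sup>2 * \<Lambda> / 3 * (1 - 2 * u\<^sup>2) - 1)"
definition H2 :: "real \<Rightarrow> real" where "H2 u = 2 * (a\<^sup>2 * \<Lambda> / 3 * (1 - 6 * u\<^sup>2) - 1)"

lemma S_r [derivative_intros]: "((\<lambda>r. S r u) has_real_derivative 2 * r) (at r within X)"
  and S_u [derivative_intros]: "((\<lambda>u. S r u) has_real_derivative 2 * a\<^sup>2 * u) (at u within X)"
  and D_r [derivative_intros]: "(D has_real_derivative D1 r) (at r within X)"
  and D1_r [derivative_intros]: "(D1 has_real_derivative D2 r) (at r within X)"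
  and H_u [derivative_intros]: "(H has_real_derivative H1 u) (at u within X)"
  and H1_u [derivative_intros]: "(H1 has_real_derivative H2 u) (at u within X)"
  unfolding S_def D_def[abs_def] D1_def[abs_def] D2_def H_def[abs_def] H1_def[abs_def] H2_def
  by (auto intro!: derivative_eq_intros simp: power2_eq_square field_simps)

text \<open>With \<open>\<zeta> = q + \<i> p = 1 / (r - \<i> a u)\<close> one has \<open>1 / S = p\<^sup>2 + q\<^sup>2\<close>, so the polynomials in these eight
  quantities are closed under \<open>\<partial>\<^sub>r\<close> and \<open>\<partial>\<^sub>u\<close>, up to the derivatives of \<open>z\<close> and \<open>w\<close>, which do not
  occur.  This keeps powers of \<open>S\<close> out of the curvature computation.\<close>

definition q :: "real \<Rightarrow> real \<Rightarrow> real" where "q r u = r / S r u"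
definition p :: "real \<Rightarrow> real \<Rightarrow> real" where "p r u = a * u / S r u"
definition f :: "real \<Rightarrow> real \<Rightarrow> real" where "f r u = D r / S r u"
definition h :: "real \<Rightarrow> real \<Rightarrow> real" where "h r u = H u / S r u"
definition x :: "real \<Rightarrow> real \<Rightarrow> real" where "x r u = D1 r / (2 * S r u)"
definition y :: "real \<Rightarrow> real \<Rightarrow> real" where "y r u = H1 u / (2 * S r u)"
definition z :: "real \<Rightarrow> real \<Rightarrow> real" where "z r u = D2 r / (2 * S r u)"
definition w :: "real \<Rightarrow> real \<Rightarrow> real" where "w r u = H2 u / (2 * S r u)"

text \<open>The frame is \<open>e\<^sub>1 \<sim> (r\<^sup>2 + a\<^sup>2) \<partial>\<^sub>t + a \<partial>\<^sub>\<phi>\<close>, \<open>e\<^sub>2 = \<partial>\<^sub>r\<close>, \<open>e\<^sub>3 = \<partial>\<^sub>u\<close> with \<open>u = cos \<theta>\<close>, and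
  \<open>e\<^sub>4 \<sim> a sin\<^sup>2\<theta> \<partial>\<^sub>t + \<partial>\<^sub>\<phi>\<close>.  It is left unnormalised, because \<open>D\<close> changes sign at the horizons and
  square roots would appear.  The connection \<open>W\<close> below comes from the Koszul formula; its symmetric
  part is half the derivative of \<open>N\<close>.\<close>

definition N :: "real \<Rightarrow> real \<Rightarrow> real ^ 4" where
  "N r u = (let f = f r u; h = h r u in
     vector [- f, 1 / f, 1 / h, h])"
definition N_r :: "real \<Rightarrow> real \<Rightarrow> real ^ 4" where
  "N_r r u = (let q = q r u; f = f r u; h = h r u; x = x r u in
     vector [2 * q * f - 2 * x, 2 * q / f - 2 * x / f\<^sup>2, 2 * q / h, - (2 * q * h)])"
definition N_u :: "real \<Rightarrow> real \<Rightarrow> real ^ 4" where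
  "N_u r u = (let p = p r u; f = f r u; h = h r u; y = y r u in
     vector [2 * a * p * f, 2 * a * p / f, 2 * a * p / h - 2 * y / h\<^sup>2, 2 * y - 2 * a * p * h])"

definition W :: "real \<Rightarrow> real \<Rightarrow> real ^ 4 ^ 4 ^ 4" where
  "W r u = (let q = q r u; p = p r u; f = f r u; h = h r u; x = x r u; y = y r u in
     vector
      [skew_plus_diag 0 0 0 0
         (q * f - x) (- (a * p * f)) 0 0 (a * q * h) (- (p * f)),
       skew_plus_diag (q * f - x) (q / f - x / f\<^sup>2) (q / h) (- (q * h))
         0 0 (- (a * q * h)) (a * p / f) 0 0,
       skew_plus_diag (a * p * f) (a * p / f) (a * p / h - y / h\<^sup>2) (y - a * p * h)
         0 0 (- (p * f)) (- (q / h)) 0 0,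
       skew_plus_diag 0 0 0 0
         (- (a * q * h)) (p * f) 0 0 (- (q * h)) (a * p * h - y)])"
definition W_r :: "real \<Rightarrow> real \<Rightarrow> real ^ 4 ^ 4 ^ 4" where
  "W_r r u = (let q = q r u; p = p r u; f = f r u; h = h r u; x = x r u; y = y r u; z = z r u in
     vector
      [skew_plus_diag 0 0 0 0
         (4 * q * x + p\<^sup>2 * f - z - 3 * q\<^sup>2 * f) (4 * a * p * q * f - 2 * a * p * x) 0 0 (a * p\<^sup>2 * h - 3 * a * q\<^sup>2 * h) (4 * p * q * f - 2 * p * x),
       skew_plus_diag (4 * q * x + p\<^sup>2 * f - z - 3 * q\<^sup>2 * f) (4 * x\<^sup>2 / f ^ 3 + p\<^sup>2 / f + q\<^sup>2 / f - z / f\<^sup>2 - 4 * q * x / f\<^sup>2) (p\<^sup>2 / h + q\<^sup>2 / h) (3 * q\<^sup>2 * h - p\<^sup>2 * h)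
         0 0 (3 * a * q\<^sup>2 * h - a * p\<^sup>2 * h) (- (2 * a * p * x / f\<^sup>2)) 0 0,
       skew_plus_diag (2 * a * p * x - 4 * a * p * q * f) (- (2 * a * p * x / f\<^sup>2)) (- (2 * q * y / h\<^sup>2)) (4 * a * p * q * h - 2 * q * y)
         0 0 (4 * p * q * f - 2 * p * x) (- (p\<^sup>2 / h) - q\<^sup>2 / h) 0 0,
       skew_plus_diag 0 0 0 0
         (3 * a * q\<^sup>2 * h - a * p\<^sup>2 * h) (2 * p * x - 4 * p * q * f) 0 0 (3 * q\<^sup>2 * h - p\<^sup>2 * h) (2 * q * y - 4 * a * p * q * h)])"
definition W_u :: "real \<Rightarrow> real \<Rightarrow> real ^ 4 ^ 4 ^ 4" where
  "W_u r u = (let q = q r u; p = p r u; f = f r u; h = h r u; x = x r u; y = y r u; w = w r u in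
     vector
      [skew_plus_diag 0 0 0 0
         (2 * a * p * x - 4 * a * p * q * f) (3 * a\<^sup>2 * p\<^sup>2 * f - a\<^sup>2 * q\<^sup>2 * f) 0 0 (2 * a * q * y - 4 * a\<^sup>2 * p * q * h) (3 * a * p\<^sup>2 * f - a * q\<^sup>2 * f),
       skew_plus_diag (2 * a * p * x - 4 * a * p * q * f) (- (2 * a * p * x / f\<^sup>2)) (- (2 * q * y / h\<^sup>2)) (4 * a * p * q * h - 2 * q * y)
         0 0 (4 * a\<^sup>2 * p * q * h - 2 * a * q * y) (a\<^sup>2 * q\<^sup>2 / f + a\<^sup>2 * p\<^sup>2 / f) 0 0,
       skew_plus_diag (a\<^sup>2 * q\<^sup>2 * f - 3 * a\<^sup>2 * p\<^sup>2 * f) (a\<^sup>2 * q\<^sup>2 / f + a\<^sup>2 * p\<^sup>2 / f) (4 * y\<^sup>2 / h ^ 3 + a\<^sup>2 * q\<^sup>2 / h + a\<^sup>2 * p\<^sup>2 / h - w / h\<^sup>2 - 4 * a * p * y / h\<^sup>2) (3 * a\<^sup>2 * p\<^sup>2 * h + w - a\<^sup>2 * q\<^sup>2 * h - 4 * a * p * y)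
         0 0 (3 * a * p\<^sup>2 * f - a * q\<^sup>2 * f) (2 * q * y / h\<^sup>2) 0 0,
       skew_plus_diag 0 0 0 0
         (4 * a\<^sup>2 * p * q * h - 2 * a * q * y) (a * q\<^sup>2 * f - 3 * a * p\<^sup>2 * f) 0 0 (4 * a * p * q * h - 2 * q * y) (4 * a * p * y + a\<^sup>2 * q\<^sup>2 * h - w - 3 * a\<^sup>2 * p\<^sup>2 * h)])"

section \<open>Derivatives and field equations in the rational quantities\<close>

context
  fixes r u :: real
  assumes S0: "S r u \<noteq> 0"
begin

lemma S_inverse: "1 / S r u = (p r u)\<^sup>2 + (q r u)\<^sup>2"
proof -
  have "(p r u)\<^sup>2 + (q r u)\<^sup>2 = S r u / (S r u)\<^sup>2"
    by (simp add: p_def q_def power_divide add_divide_distrib[symmetric] power_mult_distrib) (simp add: S_def)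
  then show ?thesis using S0 by (simp add: power2_eq_square)
qed

text \<open>Since \<open>S\<close> has derivative \<open>2 * r\<close>, the logarithmic derivative
  of \<open>1 / S\<close> is \<open>- 2 * q\<close>, and no higher power of \<open>S\<close>
  appears.\<close>

lemma DERIV_divide_S:
  assumes "(n has_real_derivative n') (at r)"
  shows "((\<lambda>r. n r / S r u) has_real_derivative n' / S r u - 2 * q r u * (n r / S r u)) (at r)"
  using S0 by (auto intro!: derivative_eq_intros assms simp: q_def field_simps power2_eq_square)

lemma DERIV_divide_S':
  assumes "(n has_real_derivative n') (at u)"
  shows "((\<lambda>u. n u / S r u) has_real_derivative n' / S r u - 2 * a * p r u * (n u / S r u)) (at u)"
  using S0 by (auto intro!: derivative_eq_intros assms simp: p_def field_simps power2_eq_square)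

lemma atom_derivs_r:
  "((\<lambda>r. q r u) has_real_derivative (p r u)\<^sup>2 - (q r u)\<^sup>2) (at r)"
  "((\<lambda>r. p r u) has_real_derivative - 2 * p r u * q r u) (at r)"
  "((\<lambda>r. f r u) has_real_derivative 2 * x r u - 2 * q r u * f r u) (at r)"
  "((\<lambda>r. h r u) has_real_derivative - 2 * q r u * h r u) (at r)"
  "((\<lambda>r. x r u) has_real_derivative z r u - 2 * q r u * x r u) (at r)"
  "((\<lambda>r. y r u) has_real_derivative - 2 * q r u * y r u) (at r)"
proof -
  have "((\<lambda>r. q r u) has_real_derivative 1 / S r u - 2 * q r u * q r u) (at r)"
    using DERIV_divide_S[of "\<lambda>r. r" 1] by (simp add: q_def)
  then show "((\<lambda>r. q r u) has_real_derivative (p r u)\<^sup>2 - (q r u)\<^sup>2) (at r)"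
    unfolding S_inverse by (simp add: power2_eq_square)
  show "((\<lambda>r. p r u) has_real_derivative - 2 * p r u * q r u) (at r)"
    using DERIV_divide_S[of "\<lambda>r. a * u" 0] by (simp add: p_def mult_ac)
  show "((\<lambda>r. f r u) has_real_derivative 2 * x r u - 2 * q r u * f r u) (at r)"
    using DERIV_divide_S[OF D_r] by (simp add: f_def x_def)
  show "((\<lambda>r. h r u) has_real_derivative - 2 * q r u * h r u) (at r)"
    using DERIV_divide_S[of "\<lambda>r. H u" 0] by (simp add: h_def)
  show "((\<lambda>r. x r u) has_real_derivative z r u - 2 * q r u * x r u) (at r)"
    using DERIV_divide_S[OF DERIV_cdivide[OF D1_r, of 2]] by (simp add: x_def z_def)
  show "((\<lambda>r. y r u) has_real_derivative - 2 * q r u * y r u) (at r)"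
    using DERIV_divide_S[of "\<lambda>r. H1 u / 2" 0] by (simp add: y_def)
qed

lemma atom_derivs_u:
  "((\<lambda>u. q r u) has_real_derivative - 2 * a * p r u * q r u) (at u)"
  "((\<lambda>u. p r u) has_real_derivative a * ((q r u)\<^sup>2 - (p r u)\<^sup>2)) (at u)"
  "((\<lambda>u. f r u) has_real_derivative - 2 * a * p r u * f r u) (at u)"
  "((\<lambda>u. h r u) has_real_derivative 2 * y r u - 2 * a * p r u * h r u) (at u)"
  "((\<lambda>u. x r u) has_real_derivative - 2 * a * p r u * x r u) (at u)"
  "((\<lambda>u. y r u) has_real_derivative w r u - 2 * a * p r u * y r u) (at u)"
proof -
  have "((\<lambda>u. p r u) has_real_derivative a * (1 / S r u) - 2 * a * p r u * p r u) (at u)"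
    using DERIV_divide_S'[OF DERIV_cmult[OF DERIV_ident, of a]] by (simp add: p_def)
  then show "((\<lambda>u. p r u) has_real_derivative a * ((q r u)\<^sup>2 - (p r u)\<^sup>2)) (at u)"
    unfolding S_inverse by (simp add: power2_eq_square algebra_simps)
  show "((\<lambda>u. q r u) has_real_derivative - 2 * a * p r u * q r u) (at u)"
    using DERIV_divide_S'[of "\<lambda>u. r" 0] by (simp add: q_def)
  show "((\<lambda>u. f r u) has_real_derivative - 2 * a * p r u * f r u) (at u)"
    using DERIV_divide_S'[of "\<lambda>u. D r" 0] by (simp add: f_def)
  show "((\<lambda>u. h r u) has_real_derivative 2 * y r u - 2 * a * p r u * h r u) (at u)"
    using DERIV_divide_S'[OF H_u] by (simp add: h_def y_def)
  show "((\<lambda>u. x r u) has_real_derivative - 2 * a * p r u * x r u) (at u)"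
    using DERIV_divide_S'[of "\<lambda>u. D1 r / 2" 0] by (simp add: x_def)
  show "((\<lambda>u. y r u) has_real_derivative w r u - 2 * a * p r u * y r u) (at u)"
    using DERIV_divide_S'[OF DERIV_cdivide[OF H1_u, of 2]] by (simp add: y_def w_def)
qed

text \<open>The first two equations are \<open>R\<^sub>1\<^sub>2\<^sub>1\<^sub>2\<close> and \<open>R\<^sub>3\<^sub>4\<^sub>3\<^sub>4\<close>, the third is
  half of \<open>R\<^sub>3\<^sub>4\<^sub>1\<^sub>2\<close>, the fourth a rescaled \<open>R\<^sub>1\<^sub>3\<^sub>1\<^sub>3\<close>.  Every other component reduces to these, and the
  explicit polynomials \<open>D\<close> and \<open>H\<close> are used nowhere else in the curvature.\<close>

lemma field_equations:
  defines "s \<equiv> S r u" and "i \<equiv> 1 / S r u"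
  shows
  "z r u + 4 * (q r u)\<^sup>2 * f r u + a\<^sup>2 * (p r u)\<^sup>2 * h r u - ((p r u)\<^sup>2 + (q r u)\<^sup>2) * f r u - 4 * q r u * x r u
     - 3 * a\<^sup>2 * (q r u)\<^sup>2 * h r u = - 2 * m * (q r u ^ 3 - 3 * q r u * (p r u)\<^sup>2) - \<Lambda> / 3" (is ?E1)
  "3 * (p r u)\<^sup>2 * f r u + 4 * a * p r u * y r u + a\<^sup>2 * ((p r u)\<^sup>2 + (q r u)\<^sup>2) * h r u - w r u - (q r u)\<^sup>2 * f r u
     - 4 * a\<^sup>2 * (p r u)\<^sup>2 * h r u = 2 * m * (q r u ^ 3 - 3 * q r u * (p r u)\<^sup>2) + \<Lambda> / 3" (is ?E2)
  "2 * a\<^sup>2 * q r u * p r u * h r u + p r u * x r u - a * q r u * y r u - 2 * q r u * p r u * f r u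
     = m * (3 * (q r u)\<^sup>2 * p r u - p r u ^ 3)" (is ?E3)
  "a\<^sup>2 * (q r u)\<^sup>2 * h r u + (p r u)\<^sup>2 * f r u + q r u * x r u + a * p r u * y r u - (q r u)\<^sup>2 * f r u
     - a\<^sup>2 * (p r u)\<^sup>2 * h r u = m * (q r u ^ 3 - 3 * q r u * (p r u)\<^sup>2) - \<Lambda> / 3" (is ?E4)
proof -
  have si: "s * i = 1" using S0 by (simp add: s_def i_def)
  note atoms = q_def p_def f_def h_def x_def y_def z_def w_def
  have subst: "q r u = r * i" "p r u = a * u * i" "f r u = D r * i" "h r u = H u * i" "2 * x r u = D1 r * i"
     "2 * y r u = H1 u * i" "2 * z r u = D2 r * i" "2 * w r u = H2 u * i" "(p r u)\<^sup>2 + (q r u)\<^sup>2 = i"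
    unfolding S_inverse[symmetric] i_def by (simp_all add: atoms)
  \<comment> \<open>Each identity proved in this way is the equation multiplied by
    \<open>6 * s ^ 3\<close> (the third by \<open>2 * s ^ 3\<close>), hence polynomial in
    \<open>r\<close> and \<open>u\<close>; \<open>si\<close> undoes the multiplication.\<close>
  have "3 * s\<^sup>2 * D2 r + 24 * r\<^sup>2 * D r + 6 * a^4 * u\<^sup>2 * H u - 6 * s * D r - 12 * r * D1 r * s - 18 * a\<^sup>2 * r\<^sup>2 * H u
    = - 12 * m * (r^3 - 3 * r * (a * u)\<^sup>2) - 2 * \<Lambda> * s ^ 3"
    unfolding s_def S_def D_def D1_def D2_def H_def by (simp add: field_simps) algebra
  then show ?E1 using si subst by algebra
  have "6 * a\<^sup>2 * u\<^sup>2 * D r + 12 * a\<^sup>2 * u * H1 u * s + 6 * a\<^sup>2 * s * H u - 3 * H2 u * s\<^sup>2 - 6 * r\<^sup>2 * D r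
      + 12 * a\<^sup>2 * u\<^sup>2 * D r - 24 * a^4 * u\<^sup>2 * H u = 12 * m * (r^3 - 3 * r * (a * u)\<^sup>2) + 2 * \<Lambda> * s ^ 3"
    unfolding s_def S_def D_def H_def H1_def H2_def by (simp add: field_simps) algebra
  then show ?E2 using si subst by algebra
  have "4 * a^3 * r * u * H u + a * u * D1 r * s - a * r * H1 u * s - 4 * a * r * u * D r
    = 2 * m * (3 * r\<^sup>2 * (a * u) - (a * u)^3)"
    unfolding s_def S_def D_def D1_def H1_def H_def by (simp add: field_simps) algebra
  then show ?E3 using si subst by algebra
  have "6 * a\<^sup>2 * r\<^sup>2 * H u + 6 * a\<^sup>2 * u\<^sup>2 * D r + 3 * r * D1 r * s + 3 * a\<^sup>2 * u * H1 u * s - 6 * r\<^sup>2 * D r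
      - 6 * a^4 * u\<^sup>2 * H u = 6 * m * (r^3 - 3 * r * (a * u)\<^sup>2) - 2 * \<Lambda> * s ^ 3"
    unfolding s_def S_def D_def D1_def H_def H1_def by (simp add: field_simps) algebra
  then show ?E4 using si subst by algebra
qed

context
  assumes D0: "D r \<noteq> 0" and H0: "H u \<noteq> 0"
begin

lemma fh_nz: "f r u \<noteq> 0" "h r u \<noteq> 0"
  using S0 D0 H0 by (simp_all add: f_def h_def)

lemma N_deriv_r: "((\<lambda>r. N r u $ c) has_real_derivative N_r r u $ c) (at r)"
proof -
  have "\<forall>c. ((\<lambda>r. N r u $ c) has_real_derivative N_r r u $ c) (at r)"
    unfolding forall_4 N_def N_r_def vector_4 Let_def
    by (intro conjI) (rule derivative_eq_intros atom_derivs_r[THEN DERIV_cong] refl fh_nz | simp add: field_simps power2_eq_square fh_nz)+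
  then show ?thesis by blast
qed

lemma N_deriv_u: "((\<lambda>u. N r u $ c) has_real_derivative N_u r u $ c) (at u)"
proof -
  have "\<forall>c. ((\<lambda>u. N r u $ c) has_real_derivative N_u r u $ c) (at u)"
    unfolding forall_4 N_def N_u_def vector_4 Let_def
    by (intro conjI) (rule derivative_eq_intros atom_derivs_u[THEN DERIV_cong] refl fh_nz | simp add: field_simps power2_eq_square fh_nz)+
  then show ?thesis by blast
qed

lemma W_deriv_r: "((\<lambda>r. W r u $ c $ i $ j) has_real_derivative W_r r u $ c $ i $ j) (at r)"
proof -
  have "\<forall>c. ((\<lambda>r. W r u $ c $ i $ j) has_real_derivative W_r r u $ c $ i $ j) (at r)"
    unfolding forall_4 W_def W_r_def vector_4 Let_def
    by (intro conjI skew_plus_diag_deriv) (rule derivative_eq_intros atom_derivs_r[THEN DERIV_cong] refl fh_nz | simp add: field_simps power2_eq_square power3_eq_cube fh_nz)+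
  then show ?thesis by blast
qed

lemma W_deriv_u: "((\<lambda>u. W r u $ c $ i $ j) has_real_derivative W_u r u $ c $ i $ j) (at u)"
proof -
  have "\<forall>c. ((\<lambda>u. W r u $ c $ i $ j) has_real_derivative W_u r u $ c $ i $ j) (at u)"
    unfolding forall_4 W_def W_u_def vector_4 Let_def
    by (intro conjI skew_plus_diag_deriv) (rule derivative_eq_intros atom_derivs_u[THEN DERIV_cong] refl fh_nz | simp add: field_simps power2_eq_square power3_eq_cube fh_nz)+
  then show ?thesis by blast
qed

end

end

section \<open>Curvature components in the Carter frame\<close>

definition psi_re :: "real \<Rightarrow> real \<Rightarrow> real" where
  "psi_re r u = m * (q r u ^ 3 - 3 * q r u * (p r u)\<^sup>2)"
definition psi_im :: "real \<Rightarrow> real \<Rightarrow> real" where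
  "psi_im r u = m * (3 * (q r u)\<^sup>2 * p r u - p r u ^ 3)"

text \<open>In type D the Weyl components on the adapted frame are
  \<open>\<kappa>\<^sub>i\<^sub>j (Re \<Psi> (N\<^sub>i\<^sub>k N\<^sub>j\<^sub>l - N\<^sub>i\<^sub>l N\<^sub>j\<^sub>k) + Im \<Psi> \<epsilon>\<^sub>i\<^sub>j\<^sub>k\<^sub>l)\<close>, where \<open>\<Psi> = m \<zeta>\<^sup>3\<close> and \<open>\<kappa>\<close> is 2 on the two
  invariant planes and -1 on the mixed ones.\<close>

definition weyl_comp :: "real \<Rightarrow> real \<Rightarrow> 4 \<Rightarrow> 4 \<Rightarrow> 4 \<Rightarrow> 4 \<Rightarrow> real" where
  "weyl_comp r u i j k l = plane_weight $ i $ j * (psi_re r u * (N r u $ i * N r u $ j * ((if i = k then 1 else 0) * (if j = l then 1 else 0)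
          - (if i = l then 1 else 0) * (if j = k then 1 else 0))) + psi_im r u * levi_civita i j k l)"

text \<open>The first and last frame vectors are combinations of the coordinate fields of t and phi,
  so they annihilate functions of \<open>r\<close> and \<open>u\<close>.\<close>

definition e_W :: "real \<Rightarrow> real \<Rightarrow> 4 \<Rightarrow> 4 \<Rightarrow> 4 \<Rightarrow> 4 \<Rightarrow> real" where
  "e_W r u c d i j = vector [0, W_r r u $ d $ i $ j, W_u r u $ d $ i $ j, 0] $ c"

definition frame_curv :: "real \<Rightarrow> real \<Rightarrow> 4 \<Rightarrow> 4 \<Rightarrow> 4 \<Rightarrow> 4 \<Rightarrow> real" where
  "frame_curv r u i j c d = e_W r u c d i j - e_W r u d c i j
     - (\<Sum>e\<in>UNIV. (W r u $ c $ e $ i * W r u $ d $ e $ j - W r u $ d $ e $ i * W r u $ c $ e $ j) / N r u $ e)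
     + (\<Sum>f\<in>UNIV. (W r u $ d $ f $ c - W r u $ c $ f $ d) * W r u $ f $ i $ j / N r u $ f)"

text \<open>Together with \<open>riemann_comp_antisym\<close> this cuts the 256 components down to
  six index pairs with sixteen components each.\<close>

lemma frame_curv_antisym: "frame_curv r u i j d c = - frame_curv r u i j c d"
proof -
  have "(\<Sum>e\<in>UNIV. (W r u $ d $ e $ i * W r u $ c $ e $ j - W r u $ c $ e $ i * W r u $ d $ e $ j) / N r u $ e)
     = - (\<Sum>e\<in>UNIV. (W r u $ c $ e $ i * W r u $ d $ e $ j - W r u $ d $ e $ i * W r u $ c $ e $ j) / N r u $ e)"
    by (simp add: sum_negf[symmetric] minus_divide_left)
  moreover have "(\<Sum>f\<in>UNIV. (W r u $ c $ f $ d - W r u $ d $ f $ c) * W r u $ f $ i $ j / N r u $ f)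
     = - (\<Sum>f\<in>UNIV. (W r u $ d $ f $ c - W r u $ c $ f $ d) * W r u $ f $ i $ j / N r u $ f)"
    by (simp add: sum_negf[symmetric] minus_divide_left minus_mult_left)
  ultimately show ?thesis unfolding frame_curv_def by simp
qed

definition riemann_comp :: "real \<Rightarrow> real \<Rightarrow> 4 \<Rightarrow> 4 \<Rightarrow> 4 \<Rightarrow> 4 \<Rightarrow> real" where
  "riemann_comp r u i j k l = weyl_comp r u i j k l + \<Lambda> / 3 * (N r u $ i * N r u $ j * ((if i = k then 1 else 0) * (if j = l then 1 else 0)
          - (if i = l then 1 else 0) * (if j = k then 1 else 0)))"

lemma riemann_comp_antisym: "riemann_comp r u i j l k = - riemann_comp r u i j k l"
proof -
  have "levi_civita i j l k = - levi_civita i j k l" by (simp add: levi_civita_def) algebra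
  then show ?thesis by (simp add: riemann_comp_def weyl_comp_def algebra_simps)
qed

lemmas table_defs = N_def W_def W_r_def W_u_def psi_re_def psi_im_def skew_plus_diag_def levi_civita_def index_number_def plane_weight_def Let_def

context
  fixes r u :: real
  assumes S0: "S r u \<noteq> 0" and D0: "D r \<noteq> 0" and H0: "H u \<noteq> 0"
begin

text \<open>Once the denominators \<open>f\<close> and \<open>h\<close> are cleared, whatever is not
  an identity follows polynomially from \<open>field_equations\<close>. The other five pairs are
  alike.\<close>

lemma frame_curv_12: "\<forall>i j. frame_curv r u i j 1 2 = riemann_comp r u i j 1 2"
  unfolding forall_4 frame_curv_def e_W_def sum_4 riemann_comp_def weyl_comp_def using fh_nz[OF S0 D0 H0]
  by (intro conjI; simp add: table_defs; (simp add: field_simps power2_eq_square power3_eq_cube power4_eq_xxxx)?;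
    (use field_equations[OF S0] in algebra)?)

lemma frame_curv_13: "\<forall>i j. frame_curv r u i j 1 3 = riemann_comp r u i j 1 3"
  unfolding forall_4 frame_curv_def e_W_def sum_4 riemann_comp_def weyl_comp_def using fh_nz[OF S0 D0 H0]
  by (intro conjI; simp add: table_defs; (simp add: field_simps power2_eq_square power3_eq_cube power4_eq_xxxx)?;
    (use field_equations[OF S0] in algebra)?)

lemma frame_curv_14: "\<forall>i j. frame_curv r u i j 1 4 = riemann_comp r u i j 1 4"
  unfolding forall_4 frame_curv_def e_W_def sum_4 riemann_comp_def weyl_comp_def using fh_nz[OF S0 D0 H0]
  by (intro conjI; simp add: table_defs; (simp add: field_simps power2_eq_square power3_eq_cube power4_eq_xxxx)?;
    (use field_equations[OF S0] in algebra)?)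

lemma frame_curv_23: "\<forall>i j. frame_curv r u i j 2 3 = riemann_comp r u i j 2 3"
  unfolding forall_4 frame_curv_def e_W_def sum_4 riemann_comp_def weyl_comp_def using fh_nz[OF S0 D0 H0]
  by (intro conjI; simp add: table_defs; (simp add: field_simps power2_eq_square power3_eq_cube power4_eq_xxxx)?;
    (use field_equations[OF S0] in algebra)?)

lemma frame_curv_24: "\<forall>i j. frame_curv r u i j 2 4 = riemann_comp r u i j 2 4"
  unfolding forall_4 frame_curv_def e_W_def sum_4 riemann_comp_def weyl_comp_def using fh_nz[OF S0 D0 H0]
  by (intro conjI; simp add: table_defs; (simp add: field_simps power2_eq_square power3_eq_cube power4_eq_xxxx)?;
    (use field_equations[OF S0] in algebra)?)

lemma frame_curv_34: "\<forall>i j. frame_curv r u i j 3 4 = riemann_comp r u i j 3 4"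
  unfolding forall_4 frame_curv_def e_W_def sum_4 riemann_comp_def weyl_comp_def using fh_nz[OF S0 D0 H0]
  by (intro conjI; simp add: table_defs; (simp add: field_simps power2_eq_square power3_eq_cube power4_eq_xxxx)?;
    (use field_equations[OF S0] in algebra)?)

lemma frame_curv_eq: "frame_curv r u i j k l = riemann_comp r u i j k l"
proof -
  have "frame_curv r u i j k k = riemann_comp r u i j k k" for k
    using frame_curv_antisym[of r u i j k k] riemann_comp_antisym[of r u i j k k] by simp
  moreover have "frame_curv r u i j l k = riemann_comp r u i j l k" if "frame_curv r u i j k l = riemann_comp r u i j k l" for k l
    using that frame_curv_antisym[of r u i j l k] riemann_comp_antisym[of r u i j l k] by simp
  ultimately have "\<forall>k l. frame_curv r u i j k l = riemann_comp r u i j k l"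
    unfolding forall_4 using frame_curv_12 frame_curv_13 frame_curv_14 frame_curv_23 frame_curv_24 frame_curv_34 by simp
  then show ?thesis by blast
qed

text \<open>The Levi-Civita term vanishes because \<open>i\<close> repeats, and the real part is
  proportional to a row sum of \<open>plane_weight\<close>, which is zero.\<close>

lemma weyl_comp_trace: "(\<Sum>i\<in>UNIV. weyl_comp r u i j i l / N r u $ i) = 0"
proof -
  note nz = fh_nz[OF S0 D0 H0]
  have "\<forall>j l. (\<Sum>i\<in>UNIV. weyl_comp r u i j i l / N r u $ i) = 0"
    unfolding forall_4 sum_4 weyl_comp_def using nz
    by (intro conjI; simp add: table_defs; (simp add: field_simps)?)
  then show ?thesis by blast
qed

text \<open>The squared entries of \<open>plane_weight\<close> add up to 24, and each ordered pair
  \<open>i\<close>, \<open>j\<close> admits two orders of \<open>k\<close>, \<open>l\<close>: this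
  gives 48. The real part lives on equal pairs and the imaginary part on complementary ones, so
  there are no cross terms; the minus sign is the product of the four entries of \<open>N\<close>,
  which is -1.\<close>

lemma weyl_comp_square:
  "(\<Sum>i\<in>UNIV. \<Sum>j\<in>UNIV. \<Sum>k\<in>UNIV. \<Sum>l\<in>UNIV. (weyl_comp r u i j k l)\<^sup>2 / (N r u $ i * N r u $ j * N r u $ k * N r u $ l))
   = 48 * ((psi_re r u)\<^sup>2 - (psi_im r u)\<^sup>2)"
  unfolding sum_4 weyl_comp_def using fh_nz[OF S0 D0 H0]
  by (simp add: N_def Let_def levi_civita_def index_number_def plane_weight_def power2_eq_square)

end

end

section \<open>The frame as a function of the coordinates\<close>

locale kerr_ds_regular = kerr_ds +
  assumes Xi: "Xi a \<Lambda> \<noteq> 0"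
begin

text \<open>The third row is d(cos theta), hence its sign. The constant \<open>Xi\<close> is
  absorbed here, so that \<open>N\<close>, \<open>W\<close> and the curvature tables are free of
  it.\<close>

definition Q :: "real \<Rightarrow> real \<Rightarrow> real ^ 4 ^ 4" where
  "Q r \<theta> = vector
    [vector [1 / Xi a \<Lambda>, 0, 0, - (a * (sin \<theta>)\<^sup>2 / Xi a \<Lambda>)], vector [0, 1, 0, 0],
     vector [0, 0, - sin \<theta>, 0], vector [a / Xi a \<Lambda>, 0, 0, - ((r\<^sup>2 + a\<^sup>2) / Xi a \<Lambda>)]]"

definition P :: "real \<Rightarrow> real \<Rightarrow> real ^ 4 ^ 4" where
  "P r \<theta> = vector
    [vector [Xi a \<Lambda> * (r\<^sup>2 + a\<^sup>2) / S r (cos \<theta>), 0, 0, - (Xi a \<Lambda> * a * (sin \<theta>)\<^sup>2 / S r (cos \<theta>))],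
     vector [0, 1, 0, 0], vector [0, 0, - (1 / sin \<theta>), 0],
     vector [Xi a \<Lambda> * a / S r (cos \<theta>), 0, 0, - (Xi a \<Lambda> / S r (cos \<theta>))]]"

definition dQ :: "4 \<Rightarrow> 4 \<Rightarrow> 4 \<Rightarrow> real \<Rightarrow> real \<Rightarrow> real" where
  "dQ k b i r \<theta> = (if k = 2 \<and> b = 4 \<and> i = 4 then - (2 * r / Xi a \<Lambda>)
     else if k = 3 \<and> b = 1 \<and> i = 4 then - (2 * a * sin \<theta> * cos \<theta> / Xi a \<Lambda>)
     else if k = 3 \<and> b = 3 \<and> i = 3 then - cos \<theta> else 0)"

definition ddQ :: "4 \<Rightarrow> 4 \<Rightarrow> 4 \<Rightarrow> 4 \<Rightarrow> real \<Rightarrow> real" where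
  "ddQ l k b i \<theta> = (if l = 2 \<and> k = 2 \<and> b = 4 \<and> i = 4 then - (2 / Xi a \<Lambda>)
     else if l = 3 \<and> k = 3 \<and> b = 1 \<and> i = 4 then - (2 * a * ((cos \<theta>)\<^sup>2 - (sin \<theta>)\<^sup>2) / Xi a \<Lambda>)
     else if l = 3 \<and> k = 3 \<and> b = 3 \<and> i = 3 then sin \<theta> else 0)"

text \<open>The structure coefficients of the coframe. Only the first and fourth forms contribute,
  since dr and d(cos theta) are closed.\<close>

definition torsion :: "4 \<Rightarrow> 4 \<Rightarrow> 4 \<Rightarrow> real \<Rightarrow> real \<Rightarrow> real" where
  "torsion b c d r u = vector
    [vector [vector [0, 0, - (2 * a * p r u), 0], 0, vector [2 * a * p r u, 0, 0, - (2 * p r u)], vector [0, 0, 2 * p r u, 0]],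
     0, 0,
     vector [vector [0, 2 * a * q r u, 0, 0], vector [- (2 * a * q r u), 0, 0, 2 * q r u], 0, vector [0, - (2 * q r u), 0, 0]]]
     $ b $ c $ d"

text \<open>The first structure equation is split at \<open>torsion\<close>: this half is rational
  in the frame quantities, the trigonometric half is \<open>Q_torsion\<close>.\<close>

lemma W_torsion:
  assumes "f r u \<noteq> 0" "h r u \<noteq> 0"
  shows "W r u $ d $ b $ c - W r u $ c $ b $ d = N r u $ b * torsion b c d r u"
proof -
  have "\<forall>b c d. W r u $ d $ b $ c - W r u $ c $ b $ d = N r u $ b * torsion b c d r u"
    unfolding forall_4 using assms
    by (simp add: W_def N_def torsion_def skew_plus_diag_def Let_def field_simps power2_eq_square)
  then show ?thesis by blast
qed

lemma Q_torsion:
  assumes "Xi a \<Lambda> \<noteq> 0" "S r (cos \<theta>) \<noteq> 0"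
  shows "dQ k b i r \<theta> - dQ i b k r \<theta> = (\<Sum>c\<in>UNIV. \<Sum>d\<in>UNIV. torsion b c d r (cos \<theta>) * Q r \<theta> $ c $ k * Q r \<theta> $ d $ i)"
proof -
  have s2: "(sin \<theta>)\<^sup>2 = 1 - (cos \<theta>)\<^sup>2" by (rule sin_squared_eq)
  have "\<forall>k b i. dQ k b i r \<theta> - dQ i b k r \<theta> = (\<Sum>c\<in>UNIV. \<Sum>d\<in>UNIV. torsion b c d r (cos \<theta>) * Q r \<theta> $ c $ k * Q r \<theta> $ d $ i)"
    unfolding forall_4 sum_4 using assms
    apply (simp add: dQ_def torsion_def Q_def p_def q_def s2)
    apply (simp add: field_simps)
    apply (simp add: S_def power2_eq_square algebra_simps)
    done
  then show ?thesis by blast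
qed

lemma Q_derivs:
  "((\<lambda>r. Q r \<theta> $ b $ i) has_real_derivative dQ 2 b i r \<theta>) (at r)"
  "((\<lambda>\<theta>. Q r \<theta> $ b $ i) has_real_derivative dQ 3 b i r \<theta>) (at \<theta>)"
proof -
  have "\<forall>b i. ((\<lambda>r. Q r \<theta> $ b $ i) has_real_derivative dQ 2 b i r \<theta>) (at r)"
    and "\<forall>b i. ((\<lambda>\<theta>. Q r \<theta> $ b $ i) has_real_derivative dQ 3 b i r \<theta>) (at \<theta>)"
    unfolding forall_4 Q_def dQ_def vector_4 using Xi by (auto intro!: derivative_eq_intros)
  then show "((\<lambda>r. Q r \<theta> $ b $ i) has_real_derivative dQ 2 b i r \<theta>) (at r)"
    "((\<lambda>\<theta>. Q r \<theta> $ b $ i) has_real_derivative dQ 3 b i r \<theta>) (at \<theta>)" by blast+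
qed

lemma dQ_derivs:
  "((\<lambda>r. dQ k b i r \<theta>) has_real_derivative ddQ 2 k b i \<theta>) (at r)"
  "((\<lambda>\<theta>. dQ k b i r \<theta>) has_real_derivative ddQ 3 k b i \<theta>) (at \<theta>)"
proof -
  have "\<forall>k b i. ((\<lambda>r. dQ k b i r \<theta>) has_real_derivative ddQ 2 k b i \<theta>) (at r)"
    and "\<forall>k b i. ((\<lambda>\<theta>. dQ k b i r \<theta>) has_real_derivative ddQ 3 k b i \<theta>) (at \<theta>)"
    unfolding forall_4 dQ_def ddQ_def using Xi
    by (auto intro!: derivative_eq_intros simp: field_simps power2_eq_square)
  then show "((\<lambda>r. dQ k b i r \<theta>) has_real_derivative ddQ 2 k b i \<theta>) (at r)"
    "((\<lambda>\<theta>. dQ k b i r \<theta>) has_real_derivative ddQ 3 k b i \<theta>) (at \<theta>)" by blast+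
qed

lemma P_derivs:
  assumes "sin \<theta> \<noteq> 0" "S r (cos \<theta>) \<noteq> 0"
  shows "\<exists>d. ((\<lambda>r. P r \<theta> $ i $ b) has_real_derivative d) (at r)"
    "\<exists>d. ((\<lambda>\<theta>. P r \<theta> $ i $ b) has_real_derivative d) (at \<theta>)"
proof -
  note nz = assms(1) assms(2)[unfolded S_def]
  have "\<forall>i b. \<exists>d. ((\<lambda>r. P r \<theta> $ i $ b) has_real_derivative d) (at r)"
    unfolding forall_4 P_def vector_4 S_def
    by (intro conjI; rule exI; (rule derivative_intros nz)+)
  moreover have "\<forall>i b. \<exists>d. ((\<lambda>\<theta>. P r \<theta> $ i $ b) has_real_derivative d) (at \<theta>)"
    unfolding forall_4 P_def vector_4 S_def
    by (intro conjI; rule exI; (rule derivative_intros nz)+)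
  ultimately show "\<exists>d. ((\<lambda>r. P r \<theta> $ i $ b) has_real_derivative d) (at r)"
    "\<exists>d. ((\<lambda>\<theta>. P r \<theta> $ i $ b) has_real_derivative d) (at \<theta>)" by blast+
qed

abbreviation "U \<equiv> kerr_ds_domain a m \<Lambda>"

lemma U_facts:
  assumes "v \<in> U"
  shows "sin (v $ 3) \<noteq> 0" "S (v $ 2) (cos (v $ 3)) \<noteq> 0" "D (v $ 2) \<noteq> 0" "H (cos (v $ 3)) \<noteq> 0"
proof -
  have "sin (v $ 3) > 0" using assms by (auto simp: kerr_ds_domain_def intro: sin_gt_zero)
  then show s: "sin (v $ 3) \<noteq> 0" by simp
  show "S (v $ 2) (cos (v $ 3)) \<noteq> 0" "D (v $ 2) \<noteq> 0"
    using assms by (auto simp: kerr_ds_domain_def S_def rho2_def D_def Delta_r_def)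
  have "H (cos (v $ 3)) = Delta_theta a \<Lambda> (v $ 3) * (sin (v $ 3))\<^sup>2"
    by (simp add: H_def Delta_theta_def sin_squared_eq)
  then show "H (cos (v $ 3)) \<noteq> 0" using s assms by (auto simp: kerr_ds_domain_def)
qed

lemma open_U: "open U"
proof -
  have "U = {v. 0 < v $ 3} \<inter> {v. v $ 3 < pi} \<inter> {v. rho2 a (v $ 2) (v $ 3) \<noteq> 0}
      \<inter> {v. Delta_r a m \<Lambda> (v $ 2) \<noteq> 0} \<inter> {v. 0 < Delta_theta a \<Lambda> (v $ 3)}"
    by (auto simp: kerr_ds_domain_def)
  then show ?thesis
    unfolding rho2_def Delta_r_def Delta_theta_def
    by (auto intro!: open_Int open_Collect_less open_Collect_neq continuous_intros)
qed

text \<open>The differential expanded in the second and third coframe forms, the shape that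
  \<open>moving_frame\<close> demands for \<open>N\<close> and \<open>W\<close>.\<close>

lemma has_partial_deriv_frame:
  assumes "((\<lambda>r. F r (cos (v $ 3))) has_real_derivative Fr) (at (v $ 2))"
    and "((\<lambda>u. F (v $ 2) u) has_real_derivative Fu) (at (cos (v $ 3)))"
  shows "has_partial_deriv (\<lambda>v. F (v $ 2) (cos (v $ 3))) k
     (\<Sum>c\<in>UNIV. Q (v $ 2) (v $ 3) $ c $ k * vector [0, Fr, Fu, 0] $ c) v"
proof -
  have "((\<lambda>\<theta>. F (v $ 2) (cos \<theta>)) has_real_derivative Fu * (- sin (v $ 3))) (at (v $ 3))"
    using assms(2) DERIV_cos by (rule DERIV_chain2)
  from has_partial_deriv_r_theta[OF assms(1) this, of k] show ?thesis
    using exhaust_4[of k] by (auto simp: sum_4 Q_def mult.commute)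
qed

sublocale frame: moving_frame "kerr_ds_metric a m \<Lambda>" U "\<lambda>b i v. Q (v $ 2) (v $ 3) $ b $ i"
  "\<lambda>i b v. P (v $ 2) (v $ 3) $ i $ b" "\<lambda>b v. N (v $ 2) (cos (v $ 3)) $ b"
  "\<lambda>c b d v. W (v $ 2) (cos (v $ 3)) $ c $ b $ d"
  "\<lambda>k b i v. dQ k b i (v $ 2) (v $ 3)" "\<lambda>l k b i v. ddQ l k b i (v $ 3)"
  "\<lambda>c b v. vector [0, N_r (v $ 2) (cos (v $ 3)) $ b, N_u (v $ 2) (cos (v $ 3)) $ b, 0] $ c"
  "\<lambda>c d b e v. e_W (v $ 2) (cos (v $ 3)) c d b e"
proof
  show "open U" by (rule open_U)
next
  fix v :: "real ^ 4" assume v: "v \<in> U"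
  note nz = U_facts[OF v] Xi
  note fh = fh_nz[OF nz(2,3,4)]
  have D: "Delta_r a m \<Lambda> (v $ 2) = D (v $ 2)" by (simp add: D_def Delta_r_def)
  have S: "rho2 a (v $ 2) (v $ 3) = S (v $ 2) (cos (v $ 3))" by (simp add: S_def rho2_def)
  have T: "Delta_theta a \<Lambda> (v $ 3) = H (cos (v $ 3)) / (sin (v $ 3))\<^sup>2"
    using nz by (simp add: H_def Delta_theta_def sin_squared_eq)
  have s2: "(sin (v $ 3))\<^sup>2 = 1 - (cos (v $ 3))\<^sup>2" by (rule sin_squared_eq)
  show "kerr_ds_metric a m \<Lambda> v $ i $ j = (\<Sum>b\<in>UNIV. N (v $ 2) (cos (v $ 3)) $ b * Q (v $ 2) (v $ 3) $ b $ i * Q (v $ 2) (v $ 3) $ b $ j)" for i j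
  proof -
    have "\<forall>i j. kerr_ds_metric a m \<Lambda> v $ i $ j = (\<Sum>b\<in>UNIV. N (v $ 2) (cos (v $ 3)) $ b * Q (v $ 2) (v $ 3) $ b $ i * Q (v $ 2) (v $ 3) $ b $ j)"
      unfolding kerr_ds_metric_def Let_def D S T forall_4 sum_4 using nz
      by (simp add: Q_def N_def Let_def f_def h_def axis_def) (simp add: field_simps power2_eq_square)
    then show ?thesis by blast
  qed
  show "(\<Sum>i\<in>UNIV. Q (v $ 2) (v $ 3) $ b $ i * P (v $ 2) (v $ 3) $ i $ c) = (if b = c then 1 else 0)" for b c
  proof -
    have "\<forall>b c. (\<Sum>i\<in>UNIV. Q (v $ 2) (v $ 3) $ b $ i * P (v $ 2) (v $ 3) $ i $ c) = (if b = c then 1 else 0)"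
      unfolding forall_4 sum_4 using nz
      by (simp add: Q_def P_def) (simp add: field_simps s2, simp add: S_def power2_eq_square algebra_simps)
    then show ?thesis by blast
  qed
  show "(\<Sum>b\<in>UNIV. P (v $ 2) (v $ 3) $ i $ b * Q (v $ 2) (v $ 3) $ b $ j) = (if i = j then 1 else 0)" for i j
  proof -
    have "\<forall>i j. (\<Sum>b\<in>UNIV. P (v $ 2) (v $ 3) $ i $ b * Q (v $ 2) (v $ 3) $ b $ j) = (if i = j then 1 else 0)"
      unfolding forall_4 sum_4 using nz
      by (simp add: Q_def P_def) (simp add: field_simps s2, simp add: S_def power2_eq_square algebra_simps)
    then show ?thesis by blast
  qed
  show "N (v $ 2) (cos (v $ 3)) $ b \<noteq> 0" for b
    using exhaust_4[of b] fh by (auto simp: N_def Let_def)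
  show "has_partial_deriv (\<lambda>v. Q (v $ 2) (v $ 3) $ b $ i) k (dQ k b i (v $ 2) (v $ 3)) v" for b i k
    using has_partial_deriv_r_theta[where F = "\<lambda>r \<theta>. Q r \<theta> $ b $ i" and y = v and k = k, OF Q_derivs] exhaust_4[of k]
    by (auto simp: dQ_def)
  show "has_partial_deriv (\<lambda>v. dQ k b i (v $ 2) (v $ 3)) l (ddQ l k b i (v $ 3)) v" for k b i l
    using has_partial_deriv_r_theta[where F = "\<lambda>r \<theta>. dQ k b i r \<theta>" and y = v and k = l, OF dQ_derivs] exhaust_4[of l]
    by (auto simp: ddQ_def)
  show "ddQ l k b i (v $ 3) = ddQ k l b i (v $ 3)" for l k b i
    by (simp add: ddQ_def)
  show "\<exists>d. has_partial_deriv (\<lambda>v. P (v $ 2) (v $ 3) $ i $ b) k d v" for i b k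
  proof -
    obtain d d' where "((\<lambda>r. P r (v $ 3) $ i $ b) has_real_derivative d) (at (v $ 2))"
      "((\<lambda>\<theta>. P (v $ 2) \<theta> $ i $ b) has_real_derivative d') (at (v $ 3))"
      using P_derivs[OF nz(1,2)] by blast
    from has_partial_deriv_r_theta[where F = "\<lambda>r \<theta>. P r \<theta> $ i $ b", OF this] show ?thesis by blast
  qed
  show "has_partial_deriv (\<lambda>v. N (v $ 2) (cos (v $ 3)) $ b) k
     (\<Sum>c\<in>UNIV. Q (v $ 2) (v $ 3) $ c $ k * vector [0, N_r (v $ 2) (cos (v $ 3)) $ b, N_u (v $ 2) (cos (v $ 3)) $ b, 0] $ c) v" for b k
    by (rule has_partial_deriv_frame[where F = "\<lambda>r u. N r u $ b"]) (intro N_deriv_r N_deriv_u nz)+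
  show "has_partial_deriv (\<lambda>v. W (v $ 2) (cos (v $ 3)) $ d $ b $ e) k
     (\<Sum>c\<in>UNIV. Q (v $ 2) (v $ 3) $ c $ k * e_W (v $ 2) (cos (v $ 3)) c d b e) v" for d b e k
    unfolding e_W_def
    by (rule has_partial_deriv_frame[where F = "\<lambda>r u. W r u $ d $ b $ e"]) (intro W_deriv_r W_deriv_u nz)+
  show "N (v $ 2) (cos (v $ 3)) $ b * (dQ k b i (v $ 2) (v $ 3) - dQ i b k (v $ 2) (v $ 3)) =
     (\<Sum>c\<in>UNIV. \<Sum>d\<in>UNIV. (W (v $ 2) (cos (v $ 3)) $ d $ b $ c - W (v $ 2) (cos (v $ 3)) $ c $ b $ d)
        * Q (v $ 2) (v $ 3) $ c $ k * Q (v $ 2) (v $ 3) $ d $ i)" for b k i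
    unfolding W_torsion[OF fh] Q_torsion[OF Xi nz(2)] by (simp add: sum_distrib_left mult.assoc)
  show "W (v $ 2) (cos (v $ 3)) $ c $ b $ d + W (v $ 2) (cos (v $ 3)) $ c $ d $ b =
     (if b = d then vector [0, N_r (v $ 2) (cos (v $ 3)) $ b, N_u (v $ 2) (cos (v $ 3)) $ b, 0] $ c else 0)" for c b d
  proof -
    have "\<forall>c b d. W (v $ 2) (cos (v $ 3)) $ c $ b $ d + W (v $ 2) (cos (v $ 3)) $ c $ d $ b =
     (if b = d then vector [0, N_r (v $ 2) (cos (v $ 3)) $ b, N_u (v $ 2) (cos (v $ 3)) $ b, 0] $ c else 0)"
      unfolding forall_4 using fh by (simp add: W_def N_r_def N_u_def skew_plus_diag_def Let_def)
    then show ?thesis by blast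
  qed
qed

section \<open>The invariant on the equatorial plane\<close>

lemma kerr_weyl_square:
  assumes v: "v \<in> U"
  shows "weyl_square (kerr_ds_metric a m \<Lambda>) v = 48 * ((psi_re (v $ 2) (cos (v $ 3)))\<^sup>2 - (psi_im (v $ 2) (cos (v $ 3)))\<^sup>2)"
proof -
  note nz = U_facts(2,3,4)[OF v]
  have "weyl_square (kerr_ds_metric a m \<Lambda>) v = (\<Sum>i\<in>UNIV. \<Sum>j\<in>UNIV. \<Sum>k\<in>UNIV. \<Sum>l\<in>UNIV. (weyl_comp (v $ 2) (cos (v $ 3)) i j k l)\<^sup>2
     / (N (v $ 2) (cos (v $ 3)) $ i * N (v $ 2) (cos (v $ 3)) $ j * N (v $ 2) (cos (v $ 3)) $ k * N (v $ 2) (cos (v $ 3)) $ l))"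
  proof (rule frame.einstein_weyl_square[OF v, where \<kappa> = "\<Lambda> / 3"])
    fix i j k l :: 4
    show "frame.frame_riemann i j k l v = weyl_comp (v $ 2) (cos (v $ 3)) i j k l
      + \<Lambda> / 3 * (N (v $ 2) (cos (v $ 3)) $ i * N (v $ 2) (cos (v $ 3)) $ j * ((if i = k then 1 else 0) * (if j = l then 1 else 0)
          - (if i = l then 1 else 0) * (if j = k then 1 else 0)))"
      using frame_curv_eq[OF nz, of i j k l] unfolding frame.frame_riemann_def frame_curv_def riemann_comp_def .
  qed (use weyl_comp_trace[OF nz] in simp_all)
  then show ?thesis unfolding weyl_comp_square[OF nz] .
qed

text \<open>The derivatives of \<open>48 m\<^sup>2 Re \<zeta>\<^sup>6\<close>, from \<open>\<partial>\<^sub>r \<zeta> = - \<zeta>\<^sup>2\<close> and \<open>\<partial>\<^sub>u \<zeta> = \<i> a \<zeta>\<^sup>2\<close>.\<close>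

definition K_r :: "real \<Rightarrow> real \<Rightarrow> real" where
  "K_r r u = (let p = p r u; q = q r u in
     288 * m\<^sup>2 * ((q ^ 3 - 3 * q * p\<^sup>2) * (6 * p\<^sup>2 * q\<^sup>2 - q ^ 4 - p ^ 4) - (3 * q\<^sup>2 * p - p ^ 3) * (4 * q * p ^ 3 - 4 * q ^ 3 * p)))"

definition K_u :: "real \<Rightarrow> real \<Rightarrow> real" where
  "K_u r u = (let p = p r u; q = q r u in
     288 * a * m\<^sup>2 * ((q ^ 3 - 3 * q * p\<^sup>2) * (4 * q * p ^ 3 - 4 * q ^ 3 * p) - (3 * q\<^sup>2 * p - p ^ 3) * (q ^ 4 + p ^ 4 - 6 * p\<^sup>2 * q\<^sup>2)))"

lemma K_derivs:
  assumes "S r u \<noteq> 0"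
  shows "((\<lambda>r. 48 * ((psi_re r u)\<^sup>2 - (psi_im r u)\<^sup>2)) has_real_derivative K_r r u) (at r)"
    and "((\<lambda>u. 48 * ((psi_re r u)\<^sup>2 - (psi_im r u)\<^sup>2)) has_real_derivative K_u r u) (at u)"
  unfolding psi_re_def psi_im_def K_r_def K_u_def Let_def
  by ((rule derivative_eq_intros atom_derivs_r[OF assms, THEN DERIV_cong] atom_derivs_u[OF assms, THEN DERIV_cong] refl)+, simp, algebra)+

definition I5_fun :: "real \<Rightarrow> real \<Rightarrow> real" where
  "I5_fun r u = f r u * (K_r r u)\<^sup>2 + h r u * (K_u r u)\<^sup>2"

lemma I5_eq:
  assumes v: "v \<in> U"
  shows "I5 (kerr_ds_metric a m \<Lambda>) v = I5_fun (v $ 2) (cos (v $ 3))"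
proof -
  note nz = U_facts(2,3,4)[OF v]
  \<comment> \<open>The gradient has only the frame components 2 and 3, where \<open>1 / N\<close>
    is \<open>f\<close> and \<open>h\<close>.\<close>
  define X where "X b = - vector [0, K_r (v $ 2) (cos (v $ 3)), K_u (v $ 2) (cos (v $ 3)), 0] $ b" for b :: 4
  have k: "k_covector (kerr_ds_metric a m \<Lambda>) v i = (\<Sum>b\<in>UNIV. Q (v $ 2) (v $ 3) $ b $ i * X b)" for i
  proof -
    have "partial_deriv i (weyl_square (kerr_ds_metric a m \<Lambda>)) v
      = partial_deriv i (\<lambda>v. 48 * ((psi_re (v $ 2) (cos (v $ 3)))\<^sup>2 - (psi_im (v $ 2) (cos (v $ 3)))\<^sup>2)) v"
      by (rule partial_deriv_cong[OF open_U v]) (rule kerr_weyl_square)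
    also have "\<dots> = (\<Sum>b\<in>UNIV. Q (v $ 2) (v $ 3) $ b $ i * vector [0, K_r (v $ 2) (cos (v $ 3)), K_u (v $ 2) (cos (v $ 3)), 0] $ b)"
      by (rule has_partial_deriv_imp, rule has_partial_deriv_frame[where F = "\<lambda>r u. 48 * ((psi_re r u)\<^sup>2 - (psi_im r u)\<^sup>2)"])
        (rule K_derivs[OF nz(1)])+
    finally show ?thesis by (simp add: k_covector_def X_def sum_negf)
  qed
  have "I5 (kerr_ds_metric a m \<Lambda>) v = (\<Sum>b\<in>UNIV. X b * X b / N (v $ 2) (cos (v $ 3)) $ b)"
    unfolding I5_def k mult.assoc by (rule frame.inv_metric_pair[OF v])
  then show ?thesis
    by (simp add: sum_4 X_def N_def Let_def I5_fun_def power2_eq_square mult_ac)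
qed

text \<open>At u = 0 the Weyl square is 48 m^2 / r^6, with radial derivative -288 m^2 / r^7. The
  constant is 288^2 / 3, the 3 being the denominator of \<open>D\<close>.\<close>

lemma I5_fun_equator:
  assumes "r \<noteq> 0"
  shows "I5_fun r 0 = - (27648 * ((\<Lambda> * r^2 - 3) * a^2 + \<Lambda> * r^4 + 6 * m * r - 3 * r^2) * m^4) / r^16"
proof -
  have p: "p r 0 = 0" and q: "q r 0 = 1 / r" and f: "f r 0 = D r / r\<^sup>2"
    using assms by (simp_all add: p_def q_def f_def S_def power2_eq_square)
  have "K_r r 0 = - (288 * m\<^sup>2 * (q r 0 ^ 3 * q r 0 ^ 4))" "K_u r 0 = 0"
    by (simp_all add: K_r_def K_u_def p)
  then have "I5_fun r 0 = D r / r\<^sup>2 * (288 * m\<^sup>2 * (1 / r) ^ 7)\<^sup>2"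
    by (simp add: I5_fun_def f q power_add[symmetric])
  also have "\<dots> = 82944 * D r * m ^ 4 / r ^ 16"
    using assms by (simp add: power_mult_distrib power_divide power_mult[symmetric] power_add[symmetric])
  also have "\<dots> = - (27648 * ((\<Lambda> * r^2 - 3) * a^2 + \<Lambda> * r^4 + 6 * m * r - 3 * r^2) * m^4) / r^16"
  proof -
    have "82944 * D r = - (27648 * ((\<Lambda> * r^2 - 3) * a^2 + \<Lambda> * r^4 + 6 * m * r - 3 * r^2))"
      by (simp add: D_def) algebra
    then show ?thesis by (simp only: mult_minus_left)
  qed
  finally show ?thesis .
qed

section \<open>Continuation to the horizons\<close>

lemma I5_fun_cont:
  assumes "S (v $ 2) (cos (v $ 3)) \<noteq> 0"
  shows "isCont (\<lambda>v. I5_fun (v $ 2) (cos (v $ 3))) v"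
proof -
  have "isCont (\<lambda>v. q (v $ 2) (cos (v $ 3))) v" "isCont (\<lambda>v. p (v $ 2) (cos (v $ 3))) v"
    "isCont (\<lambda>v. f (v $ 2) (cos (v $ 3))) v" "isCont (\<lambda>v. h (v $ 2) (cos (v $ 3))) v"
    using assms unfolding q_def p_def f_def h_def S_def D_def H_def
    by (auto intro!: continuous_intros)
  then show ?thesis
    unfolding I5_fun_def K_r_def K_u_def Let_def by (intro continuous_intros)
qed

lemma coords_nth [simp]: "coords t r \<theta> \<phi> $ 2 = r" "coords t r \<theta> \<phi> $ 3 = \<theta>"
  by (simp_all add: coords_def)

lemma equator_in_U_iff: "coords t r (pi/2) \<phi> \<in> U \<longleftrightarrow> r \<noteq> 0 \<and> D r \<noteq> 0"
  by (simp add: kerr_ds_domain_def rho2_def Delta_theta_def Delta_r_def D_def)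

lemma finite_D_roots: "finite {r. D r = 0}"
proof -
  define P where "P = [:a\<^sup>2, - 2 * m, 1 - \<Lambda> / 3 * a\<^sup>2, 0, - \<Lambda> / 3:]"
  \<comment> \<open>If the leading coefficient vanishes, then \<Lambda> = 0 and the quadratic
    coefficient is 1.\<close>
  have "P \<noteq> 0" by (auto simp: P_def)
  moreover have "poly P r = D r" for r
    by (simp add: P_def D_def power2_eq_square algebra_simps)
  ultimately show ?thesis using poly_roots_finite[of P] by simp
qed

text \<open>This is what makes the value of \<open>Lim\<close> meaningful. Delta_theta is 1 on the
  equator, so a slight increase of \<open>r\<close> reaches the domain as soon as it avoids zero and
  the finitely many roots of \<open>D\<close>.\<close>

lemma equator_islimpt: "coords t r (pi/2) \<phi> islimpt U"
  unfolding islimpt_approachable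
proof (intro allI impI)
  fix e :: real assume e: "e > 0"
  have "infinite ({r<..<r + e} - ({s. D s = 0} \<union> {0}))"
    using e finite_D_roots by (simp add: infinite_Ioo)
  then obtain s where "s \<in> {r<..<r + e} - ({s. D s = 0} \<union> {0})"
    using infinite_imp_nonempty by blast
  then have s: "r < s" "s < r + e" "D s \<noteq> 0" "s \<noteq> 0"
    by auto
  have "coords t s (pi/2) \<phi> - coords t r (pi/2) \<phi> = (s - r) *\<^sub>R axis 2 1"
    by (simp add: vec_eq_iff forall_4 coords_def axis_def)
  then have "dist (coords t s (pi/2) \<phi>) (coords t r (pi/2) \<phi>) < e"
    using s by (simp add: dist_norm)
  moreover have "coords t s (pi/2) \<phi> \<noteq> coords t r (pi/2) \<phi>"
    using s(1) coords_nth(1) less_irrefl by metis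
  ultimately show "\<exists>x'\<in>U. x' \<noteq> coords t r (pi/2) \<phi> \<and> dist x' (coords t r (pi/2) \<phi>) < e"
    using s equator_in_U_iff by blast
qed

lemma I5_tendsto:
  assumes "r \<noteq> 0"
  shows "(I5 (kerr_ds_metric a m \<Lambda>) \<longlongrightarrow> I5_fun r 0) (at (coords t r (pi/2) \<phi>) within U)"
proof -
  let ?v = "coords t r (pi/2) \<phi>"
  have "isCont (\<lambda>v. I5_fun (v $ 2) (cos (v $ 3))) ?v"
    using assms by (intro I5_fun_cont) (simp add: S_def)
  then have "((\<lambda>v. I5_fun (v $ 2) (cos (v $ 3))) \<longlongrightarrow> I5_fun r 0) (at ?v within U)"
    unfolding isCont_def using tendsto_within_subset[of _ _ ?v UNIV U] by simp
  moreover have "\<forall>\<^sub>F v in at ?v within U. I5_fun (v $ 2) (cos (v $ 3)) = I5 (kerr_ds_metric a m \<Lambda>) v"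
    using I5_eq by (auto simp: eventually_at_filter)
  ultimately show ?thesis by (rule Lim_transform_eventually)
qed

lemma kerr_ds_I5_equator:
  assumes "r \<noteq> 0"
  shows "kerr_ds_I5 a m \<Lambda> (coords t r (pi/2) \<phi>) = I5_fun r 0"
proof -
  have "Lim (at (coords t r (pi/2) \<phi>) within U) (I5 (kerr_ds_metric a m \<Lambda>)) = I5_fun r 0"
    using I5_tendsto[OF assms] equator_islimpt by (intro tendsto_Lim) (auto simp: trivial_limit_within)
  then show ?thesis
    using I5_eq by (simp add: kerr_ds_I5_def)
qed

end

theorem corollary19:
  fixes a m \<Lambda> :: real
  assumes "Xi a \<Lambda> \<noteq> 0"
  shows
    "(\<forall>t r \<phi>. r \<noteq> 0 \<and> Delta_r a m \<Lambda> r \<noteq> 0 \<longrightarrow>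
        coords t r (pi/2) \<phi> \<in> kerr_ds_domain a m \<Lambda> \<and>
        I5 (kerr_ds_metric a m \<Lambda>) (coords t r (pi/2) \<phi>) =
          - (27648 * ((\<Lambda> * r^2 - 3) * a^2 + \<Lambda> * r^4 + 6 * m * r - 3 * r^2) * m^4) / r^16) \<and>
     (\<forall>t r \<phi>. r \<noteq> 0 \<longrightarrow>
        coords t r (pi/2) \<phi> islimpt kerr_ds_domain a m \<Lambda> \<and>
        (I5 (kerr_ds_metric a m \<Lambda>) \<longlongrightarrow> kerr_ds_I5 a m \<Lambda> (coords t r (pi/2) \<phi>))
          (at (coords t r (pi/2) \<phi>) within kerr_ds_domain a m \<Lambda>) \<and>
        kerr_ds_I5 a m \<Lambda> (coords t r (pi/2) \<phi>) =
          - (27648 * ((\<Lambda> * r^2 - 3) * a^2 + \<Lambda> * r^4 + 6 * m * r - 3 * r^2) * m^4) / r^16) \<and>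
     (\<forall>t r \<phi>. r \<noteq> 0 \<and> Delta_r a m \<Lambda> r = 0 \<longrightarrow>
        kerr_ds_I5 a m \<Lambda> (coords t r (pi/2) \<phi>) = 0)"
proof -
  interpret kerr_ds_regular a m \<Lambda> by unfold_locales (rule assms)
  have D: "Delta_r a m \<Lambda> r = D r" for r by (simp add: Delta_r_def D_def)
  let ?J = "\<lambda>r. - (27648 * ((\<Lambda> * r^2 - 3) * a^2 + \<Lambda> * r^4 + 6 * m * r - 3 * r^2) * m^4) / r^16"
  have "coords t r (pi/2) \<phi> \<in> U \<and> I5 (kerr_ds_metric a m \<Lambda>) (coords t r (pi/2) \<phi>) = ?J r"
    if "r \<noteq> 0" "D r \<noteq> 0" for t r \<phi>
    unfolding I5_fun_equator[OF that(1), symmetric]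
    using that I5_eq[of "coords t r (pi/2) \<phi>"] by (simp add: equator_in_U_iff)
  moreover have "coords t r (pi/2) \<phi> islimpt U
      \<and> (I5 (kerr_ds_metric a m \<Lambda>) \<longlongrightarrow> kerr_ds_I5 a m \<Lambda> (coords t r (pi/2) \<phi>)) (at (coords t r (pi/2) \<phi>) within U)
      \<and> kerr_ds_I5 a m \<Lambda> (coords t r (pi/2) \<phi>) = ?J r" if "r \<noteq> 0" for t r \<phi>
    unfolding kerr_ds_I5_equator[OF that] I5_fun_equator[OF that, symmetric]
    using equator_islimpt I5_tendsto[OF that] by blast
  moreover have "kerr_ds_I5 a m \<Lambda> (coords t r (pi/2) \<phi>) = 0" if "r \<noteq> 0" "D r = 0" for t r \<phi>
    using that by (simp add: kerr_ds_I5_equator I5_fun_def f_def K_u_def p_def)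
  ultimately show ?thesis
    unfolding D by blast
qed

end
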